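(* Let $G$ be an $n$-vertex controllable graph with walk matrix $W$. Then for every $Q\in\mathcal{Q}(G)$ and every prime factor $p$ of $\det W$, \[ v_p(\ell(Q))\le v_p\big(d_n(W_{(p)}(G))\big), \] where $d_n(W_{(p)}(G))$ is the last invariant factor of the $p$-reduced walk matrix $W_{(p)}(G)$.
   Context: $A$ is the adjacency matrix of $G$, $e$ the all-ones vector, $J$ the all-ones matrix, $W=W(G)=[e,Ae,\dots,A^{n-1}e]$; $G$ is controllable if $W$ is non-singular. A matrix $Q$ is regular orthogonal if $Q^\top Q=I$ and $Qe=e$; $\mathcal{Q}(G)$ is the set of rational regular orthogonal $n\times n$ matrices $Q$ such that $Q^\top AQ$ is a $(0,1)$-matrix. The level $\ell(Q)$ of a rational matrix is the least positive integer $k$ with $kQ$ integral. $v_p(m)$ is the largest $k$ with $p^k\mid m$. For a non-singular integer matrix, the last invariant factor is the last diagonal entry $d_n$ of its Smith normal form $\operatorname{diag}(d_1,\dots,d_n)$, $d_1\mid\cdots\mid d_n$ positive. $\chi(G;x)=\det(xI-A)$; $\Phi_p(G;x)=\gcd(\chi(A;x),\chi(A+J;x))$, monic gcd in $\mathbb{F}_p[x]$; for monic $f=\prod_i f_i^{e_i}$ with distinct monic irreducibles $f_i$, $\operatorname{sqrt}(f)=\prod_i f_i^{\lceil e_i/2\rceil}$. Let $f_p(x)\in\mathbb{Z}[x]$ be the monic polynomial with coefficients in $\{0,\dots,p-1\}$ whose reduction mod $p$ is $\chi(G;x)/\operatorname{sqrt}\Phi_p(G;x)$, $r=\deg f_p$;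 then $W_{(p)}(G)=\big[e,Ae,\dots,A^{r-1}e,\frac{f_p(A)e}{p},\frac{Af_p(A)e}{p},\dots,\frac{A^{n-1-r}f_p(A)e}{p}\big]$ (an integer matrix when $p\mid\det W$). *)

theory Defs
  imports
    Jordan_Normal_Form.Char_Poly
    Berlekamp_Zassenhaus.Finite_Field
begin

section \<open>Graphs and walk matrices\<close>

text \<open>A graph is given by its number \<open>n\<close> of vertices, the vertices being \<open>0, \<dots>, n - 1\<close>,
  and its edge set.\<close>

definition simple_graph :: "nat \<Rightarrow> nat set set \<Rightarrow> bool" where
  "simple_graph n E \<longleftrightarrow> E \<subseteq> {{u, v} | u v. u < n \<and> v < n \<and> u \<noteq> v}"

definition adj_mat :: "nat \<Rightarrow> nat set set \<Rightarrow> int mat" where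
  "adj_mat n E = mat n n (\<lambda>(i, j). if {i, j} \<in> E then 1 else 0)"

definition ones_vec :: "nat \<Rightarrow> 'a :: one vec" where
  "ones_vec n = vec n (\<lambda>_. 1)"

definition ones_mat :: "nat \<Rightarrow> 'a :: one mat" where
  "ones_mat n = mat n n (\<lambda>_. 1)"

definition walk_mat :: "nat \<Rightarrow> nat set set \<Rightarrow> int mat" where
  "walk_mat n E = mat_of_cols n (map (\<lambda>j. (adj_mat n E ^\<^sub>m j) *\<^sub>v ones_vec n) [0..<n])"

text \<open>Non-singularity is over the rationals; \<^const>\<open>invertible_mat\<close> over \<open>int\<close> would mean
  unimodular.\<close>

definition controllable :: "nat \<Rightarrow> nat set set \<Rightarrow> bool" where
  "controllable n E \<longleftrightarrow> det (walk_mat n E) \<noteq> 0"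


section \<open>Rational regular orthogonal matrices and their level\<close>

definition regular_orthogonal_mat :: "nat \<Rightarrow> rat mat \<Rightarrow> bool" where
  "regular_orthogonal_mat n Q \<longleftrightarrow>
     Q \<in> carrier_mat n n \<and> transpose_mat Q * Q = 1\<^sub>m n \<and> Q *\<^sub>v ones_vec n = ones_vec n"

definition zero_one_mat :: "'a :: zero_neq_one mat \<Rightarrow> bool" where
  "zero_one_mat M \<longleftrightarrow> elements_mat M \<subseteq> {0, 1}"

definition QG :: "nat \<Rightarrow> nat set set \<Rightarrow> rat mat set" where
  "QG n E = {Q. regular_orthogonal_mat n Q \<and>
     zero_one_mat (transpose_mat Q * map_mat of_int (adj_mat n E) * Q)}"

definition level :: "rat mat \<Rightarrow> nat" where
  "level Q = (LEAST k. 0 < k \<and> elements_mat (of_nat k \<cdot>\<^sub>m Q) \<subseteq> \<int>)"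


section \<open>Smith normal form and last invariant factor\<close>

text \<open>Over \<open>int\<close>, \<^const>\<open>invertible_mat\<close> means invertible over \<open>int\<close>, that is, unimodular.
  The positivity of the diagonal restricts the notion to non-singular matrices.\<close>

definition smith_normal_form :: "int mat \<Rightarrow> int mat \<Rightarrow> bool" where
  "smith_normal_form M D \<longleftrightarrow>
     (\<exists>n. M \<in> carrier_mat n n \<and> D \<in> carrier_mat n n \<and>
       (\<exists>U\<in>carrier_mat n n. \<exists>V\<in>carrier_mat n n.
          invertible_mat U \<and> invertible_mat V \<and> D = U * M * V) \<and>
       diagonal_mat D \<and>
       (\<forall>i<n. 0 < D $$ (i, i)) \<and>
       (\<forall>i. Suc i < n \<longrightarrow> D $$ (i, i) dvd D $$ (Suc i, Suc i)))"

definition last_invariant_factor :: "int mat \<Rightarrow> int" where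
  "last_invariant_factor M =
     (THE d. \<exists>D. smith_normal_form M D \<and> d = D $$ (dim_row D - 1, dim_row D - 1))"


section \<open>The reduced walk matrix\<close>

text \<open>The field with \<open>p\<close> elements is \<open>'p mod_ring\<close> with \<open>CARD('p) = p\<close>; the class
  \<^class>\<open>prime_card\<close> says that this cardinality is prime. Over this field \<^const>\<open>gcd\<close> on
  polynomials is monic (unless both arguments are \<open>0\<close>), and the elements of
  \<^const>\<open>prime_factors\<close> are the distinct monic irreducible factors.\<close>

definition Phi :: "nat \<Rightarrow> nat set set \<Rightarrow> 'p :: prime_card mod_ring poly" where
  "Phi n E = gcd (of_int_poly (char_poly (adj_mat n E)))
                 (of_int_poly (char_poly (adj_mat n E + ones_mat n)))"

definition poly_sqrt :: "'a :: field_gcd poly \<Rightarrow> 'a poly" where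
  "poly_sqrt f = (\<Prod>q\<in>prime_factors f. q ^ nat \<lceil>real (multiplicity q f) / 2\<rceil>)"

text \<open>\<^const>\<open>to_int_mod_ring\<close> picks the representative in \<open>{0, \<dots>, p - 1}\<close>. The division of
  polynomials below is exact.\<close>

definition f_poly :: "'p :: prime_card itself \<Rightarrow> nat \<Rightarrow> nat set set \<Rightarrow> int poly" where
  "f_poly _ n E = map_poly to_int_mod_ring
     (of_int_poly (char_poly (adj_mat n E)) div poly_sqrt (Phi n E :: 'p mod_ring poly))"

definition poly_of_mat :: "'a :: comm_ring_1 poly \<Rightarrow> 'a mat \<Rightarrow> 'a mat" where
  "poly_of_mat f A = mat (dim_row A) (dim_row A)
     (\<lambda>(i, j). \<Sum>k\<le>degree f. poly.coeff f k * (A ^\<^sub>m k) $$ (i, j))"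

definition reduced_walk_mat_rat ::
  "'p :: prime_card itself \<Rightarrow> nat \<Rightarrow> nat set set \<Rightarrow> rat mat" where
  "reduced_walk_mat_rat P n E =
     (let A = adj_mat n E; f = f_poly P n E; r = degree f in
      mat_of_cols n
        (map (\<lambda>j. map_vec rat_of_int ((A ^\<^sub>m j) *\<^sub>v ones_vec n)) [0..<r] @
         map (\<lambda>j. (1 / of_nat CARD('p)) \<cdot>\<^sub>v
                map_vec rat_of_int ((A ^\<^sub>m j * poly_of_mat f A) *\<^sub>v ones_vec n)) [0..<n - r]))"

text \<open>The integer matrix that equals the rational matrix above. No rounding is involved: nothing
  is known about the result unless the rational matrix is integral.\<close>

definition reduced_walk_mat :: "'p :: prime_card itself \<Rightarrow> nat \<Rightarrow> nat set set \<Rightarrow> int mat" where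
  "reduced_walk_mat P n E = (THE M. map_mat rat_of_int M = reduced_walk_mat_rat P n E)"

end

theory Submission
  imports Defs
begin

text \<open>Let \<open>M = x I - A\<close> over a field, with \<open>A\<close> symmetric, and \<open>u = adj(M) e\<close>. Then
  \<open>\<chi>(A + J) = det M - e \<bullet> u\<close>, so \<open>\<Phi>\<close> divides both \<open>det M\<close> and \<open>e \<bullet> u\<close>. The minors of order 2
  of \<open>adj(M)\<close> are divisible by \<open>det M\<close>, which gives
  \<open>u\<^sub>i\<^sup>2 = (e \<bullet> u) adj(M)\<^sub>i\<^sub>i\<close> modulo \<open>det M\<close>; hence \<open>\<Phi>\<close> divides \<open>u\<^sub>i\<^sup>2\<close> and \<open>sqrt \<Phi>\<close>
  divides \<open>u\<close>. Dividing \<open>M u = \<chi> e\<close> by \<open>sqrt \<Phi>\<close> and substituting \<open>A\<close> for \<open>x\<close> yields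
  \<open>f(A) e = 0\<close>. Modulo \<open>p\<close> this applies to the adjacency matrix \<open>A\<close> and also to
  \<open>B = Q\<^sup>T A Q\<close>, which has the same \<open>\<chi>\<close> and \<open>\<Phi>\<close>. So both reduced walk matrices are
  integral, and \<open>Q\<^sup>T\<close> maps the first to the second. If \<open>d\<close> is the last invariant factor of
  the first, \<open>K\<close>, then \<open>K X = d I\<close> for an integral \<open>X\<close>, and \<open>d Q\<^sup>T = Q\<^sup>T K X\<close> is integral.\<close>


section \<open>Adjugates of symmetric matrices\<close>

lemma mult_mat_vec_nth_sum:
  assumes "A \<in> carrier_mat n m" "v \<in> carrier_vec m" "i < n"
  shows "(A *\<^sub>v v) $ i = (\<Sum>j<m. A $$ (i, j) * v $ j)"
  using assms by (auto simp: scalar_prod_def lessThan_atLeast0)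

lemma mult_mat_smult_vec:
  fixes A :: "'a :: comm_semiring_0 mat"
  assumes "A \<in> carrier_mat n m" "v \<in> carrier_vec m"
  shows "A *\<^sub>v (c \<cdot>\<^sub>v v) = c \<cdot>\<^sub>v (A *\<^sub>v v)"
  using assms by (intro eq_vecI) auto

lemma replace_col_carrier: "A \<in> carrier_mat n n \<Longrightarrow> replace_col A b k \<in> carrier_mat n n"
  by (auto simp: replace_col_def)

text \<open>Cramer's rule gives linearity in one column: \<open>?C\<close> has \<open>b\<close> as
  column \<open>k\<close>, so it sends \<open>c\<close> times the \<open>k\<close>-th unit vector to
  \<open>c\<close> times \<open>b\<close>.\<close>

lemma det_replace_col_smult:
  fixes A :: "'a :: comm_ring_1 mat"
  assumes A: "A \<in> carrier_mat n n" and b: "b \<in> carrier_vec n" and k: "k < n"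
  shows "det (replace_col A (c \<cdot>\<^sub>v b) k) = c * det (replace_col A b k)"
proof -
  let ?C = "replace_col A b k"
  have C: "?C \<in> carrier_mat n n"
    using A by (rule replace_col_carrier)
  have "?C *\<^sub>v (c \<cdot>\<^sub>v unit_vec n k) = c \<cdot>\<^sub>v b"
    using A b k C
    by (intro eq_vecI) (auto simp: replace_col_def mult_mat_smult_vec scalar_prod_right_unit)
  moreover have "det (replace_col ?C (?C *\<^sub>v (c \<cdot>\<^sub>v unit_vec n k)) k) = (c \<cdot>\<^sub>v unit_vec n k) $ k * det ?C"
    using k by (intro cramer_lemma_mat[OF C]) auto
  moreover have "replace_col ?C (c \<cdot>\<^sub>v b) k = replace_col A (c \<cdot>\<^sub>v b) k"
    by (auto simp: replace_col_def)
  ultimately show ?thesis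
    using k by simp
qed

text \<open>Jacobi's identity for the minors of order 2 of the adjugate, by Cramer's rule applied
  twice.\<close>

lemma det_dvd_adjugate_minor:
  fixes M :: "'a :: idom mat"
  assumes M: "M \<in> carrier_mat n n" and det0: "det M \<noteq> 0"
    and vecs: "x \<in> carrier_vec n" "z \<in> carrier_vec n" "u \<in> carrier_vec n" "w \<in> carrier_vec n"
    and u: "M *\<^sub>v u = det M \<cdot>\<^sub>v x" and w: "M *\<^sub>v w = det M \<cdot>\<^sub>v z"
    and i: "i < n" and j: "j < n"
  shows "det M dvd u $ i * w $ j - w $ i * u $ j"
proof -
  \<comment> \<open>The argument cancels \<open>u $ i\<close>. Exchanging the pairs
    (\<open>x\<close>, \<open>u\<close>) and (\<open>z\<close>, \<open>w\<close>) only changes the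
    sign of the minor, so a nonzero \<open>w $ i\<close> serves as well; if both vanish, so does the
    minor.\<close>
  have main: "det M dvd u $ i * w $ j - w $ i * u $ j"
    if ui: "u $ i \<noteq> 0" and vecs: "x \<in> carrier_vec n" "z \<in> carrier_vec n" "u \<in> carrier_vec n" "w \<in> carrier_vec n"
      and u: "M *\<^sub>v u = det M \<cdot>\<^sub>v x" and w: "M *\<^sub>v w = det M \<cdot>\<^sub>v z" for x z u w
  proof (cases "i = j")
    case False
    let ?C = "replace_col M x i"
    have C: "?C \<in> carrier_mat n n"
      using M by (rule replace_col_carrier)
    have "det (replace_col M (M *\<^sub>v u) i) = u $ i * det M"
      by (rule cramer_lemma_mat[OF M vecs(3) i])
    with det0 have detC: "det ?C = u $ i"
      by (simp add: u det_replace_col_smult[OF M vecs(1) i])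
    \<comment> \<open>The combination \<open>u $ i\<close> w - \<open>w $ i\<close> u vanishes at
      \<open>i\<close>, so column \<open>i\<close> of \<open>M\<close> does not act on it and can be
      replaced by \<open>x\<close>. The entry \<open>w $ i * det M\<close> at \<open>i\<close> then
      cancels the unwanted multiple of \<open>x\<close>.\<close>
    define y where "y = vec n (\<lambda>l. if l = i then w $ i * det M else u $ i * w $ l - w $ i * u $ l)"
    have y: "y \<in> carrier_vec n"
      by (simp add: y_def)
    have "?C *\<^sub>v y = (u $ i * det M) \<cdot>\<^sub>v z"
    proof (intro eq_vecI)
      fix r assume "r < dim_vec ((u $ i * det M) \<cdot>\<^sub>v z)"
      with vecs have r: "r < n" by simp
      have Mu: "(\<Sum>l<n. M $$ (r, l) * u $ l) = det M * x $ r"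
        using mult_mat_vec_nth_sum[OF M vecs(3) r] u r vecs by simp
      have Mw: "(\<Sum>l<n. M $$ (r, l) * w $ l) = det M * z $ r"
        using mult_mat_vec_nth_sum[OF M vecs(4) r] w r vecs by simp
      have "(?C *\<^sub>v y) $ r = (\<Sum>l<n. ?C $$ (r, l) * y $ l)"
        by (rule mult_mat_vec_nth_sum[OF C y r])
      also have "\<dots> = (\<Sum>l<n. (if l = i then x $ r * (w $ i * det M) else 0)
          + M $$ (r, l) * (u $ i * w $ l - w $ i * u $ l))"
        using M r by (intro sum.cong) (auto simp: y_def replace_col_def)
      also have "\<dots> = x $ r * (w $ i * det M)
          + (u $ i * (\<Sum>l<n. M $$ (r, l) * w $ l) - w $ i * (\<Sum>l<n. M $$ (r, l) * u $ l))"
        using i by (simp add: sum.distrib sum_subtractf sum_distrib_left algebra_simps)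
      also have "\<dots> = ((u $ i * det M) \<cdot>\<^sub>v z) $ r"
        unfolding Mu Mw using r vecs by (simp add: algebra_simps)
      finally show "(?C *\<^sub>v y) $ r = ((u $ i * det M) \<cdot>\<^sub>v z) $ r" .
    qed (use vecs C in auto)
    \<comment> \<open>Second use of Cramer's rule, now for \<open>?C\<close>, whose determinant is
      \<open>u $ i\<close>; this factor occurs on both sides and cancels.\<close>
    with cramer_lemma_mat[OF C y j]
    have "u $ i * (det M * det (replace_col ?C z j)) = u $ i * y $ j"
      by (simp add: detC det_replace_col_smult[OF C vecs(2) j] algebra_simps)
    with ui have "y $ j = det M * det (replace_col ?C z j)"
      by simp
    moreover have "y $ j = u $ i * w $ j - w $ i * u $ j"
      using False j by (simp add: y_def)
    ultimately show ?thesis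
      by (metis dvd_triv_left)
  qed simp
  show ?thesis
  proof (cases "u $ i = 0")
    case True
    show ?thesis
    proof (cases "w $ i = 0")
      case False
      from main[OF this vecs(2,1,4,3) w u] show ?thesis
        by (metis dvd_minus_iff minus_diff_eq)
    qed (use True in simp)
  qed (use main vecs u w in blast)
qed

text \<open>Let \<open>b\<close> be column \<open>i\<close> of the adjugate. Moving the symmetric
  \<open>M\<close> across the scalar product shows that the product of \<open>x\<close> and
  \<open>b\<close> is \<open>u $ i\<close>. Weighting the minors in \<open>u\<close> and
  \<open>b\<close> by the entries of \<open>x\<close> and summing turns the second term into the
  square of \<open>u $ i\<close>.\<close>

lemma dvd_square_of_symmetric:
  fixes M :: "'a :: idom mat"
  assumes M: "M \<in> carrier_mat n n" and sym: "transpose_mat M = M" and det0: "det M \<noteq> 0"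
    and vecs: "x \<in> carrier_vec n" "u \<in> carrier_vec n"
    and u: "M *\<^sub>v u = det M \<cdot>\<^sub>v x" and i: "i < n"
    and d: "d dvd det M" "d dvd x \<bullet> u"
  shows "d dvd (u $ i)\<^sup>2"
proof -
  define b where "b = col (Determinant.adj_mat M) i"
  note adj = Determinant.adj_mat[OF M]
  have b: "b \<in> carrier_vec n"
    using adj(1) i by (auto simp: b_def)
  have "M *\<^sub>v b = col (M * Determinant.adj_mat M) i"
    using M adj(1) i by (auto simp: b_def)
  also have "\<dots> = det M \<cdot>\<^sub>v unit_vec n i"
    using i by (auto simp: adj(2))
  finally have Mb: "M *\<^sub>v b = det M \<cdot>\<^sub>v unit_vec n i" .
  have "det M * (x \<bullet> b) = (M *\<^sub>v u) \<bullet> b"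
    using vecs b by (simp add: u)
  also have "\<dots> = u \<bullet> (M *\<^sub>v b)"
    using transpose_vec_mult_scalar[OF M b vecs(2)] sym by simp
  also have "\<dots> = det M * u $ i"
    using vecs i by (simp add: Mb scalar_prod_right_unit)
  finally have xb: "x \<bullet> b = u $ i"
    using det0 by simp
  have "det M dvd (\<Sum>j<n. x $ j * (u $ j * b $ i - b $ j * u $ i))"
    using det_dvd_adjugate_minor[OF M det0 vecs(1) unit_vec_carrier vecs(2) b u Mb _ i]
    by (intro dvd_sum dvd_mult) simp
  also have "(\<Sum>j<n. x $ j * (u $ j * b $ i - b $ j * u $ i)) = (x \<bullet> u) * b $ i - (x \<bullet> b) * u $ i"
    using vecs b by (simp add: scalar_prod_def sum_subtractf sum_distrib_left sum_distrib_right
        algebra_simps lessThan_atLeast0)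
  finally have "d dvd (x \<bullet> u) * b $ i - (u $ i)\<^sup>2"
    using d(1) unfolding xb power2_eq_square by (rule dvd_trans[rotated])
  with d(2) show ?thesis
    by (metis dvd_diff_right_iff dvd_mult2)
qed

text \<open>The matrix determinant lemma; both block factorisations below triangularise the matrix
  \<open>M\<close> bordered by \<open>x\<close> and \<open>y\<close>.\<close>

lemma det_rank_one_update:
  fixes M :: "'a :: idom mat"
  assumes M: "M \<in> carrier_mat n n" and det0: "det M \<noteq> 0"
    and vecs: "x \<in> carrier_vec n" "y \<in> carrier_vec n" "u \<in> carrier_vec n"
    and u: "M *\<^sub>v u = det M \<cdot>\<^sub>v x"
  shows "det (M - mat n n (\<lambda>(i, j). x $ i * y $ j)) = det M - y \<bullet> u"
proof -
  let ?xy = "mat n n (\<lambda>(i, j). x $ i * y $ j)"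
  define Y where "Y = mat 1 n (\<lambda>(i, j). y $ j)"
  define X where "X = mat n 1 (\<lambda>(i, j). x $ i)"
  define U where "U = mat n 1 (\<lambda>(i, j). u $ i)"
  note defs = Y_def X_def U_def
  have carr: "Y \<in> carrier_mat 1 n" "X \<in> carrier_mat n 1" "U \<in> carrier_mat n 1"
    by (auto simp: defs)
  let ?K = "four_block_mat (1\<^sub>m 1) Y X M"
  let ?L = "four_block_mat (1\<^sub>m 1) (- Y) (0\<^sub>m n 1) (1\<^sub>m n)"
  let ?R = "four_block_mat (det M \<cdot>\<^sub>m 1\<^sub>m 1) (0\<^sub>m 1 n) (- U) (1\<^sub>m n)"
  have K: "?K \<in> carrier_mat (1 + n) (1 + n)" and L: "?L \<in> carrier_mat (1 + n) (1 + n)"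
    and R: "?R \<in> carrier_mat (1 + n) (1 + n)"
    using carr M by auto
  have MU: "M * U = det M \<cdot>\<^sub>m X"
  proof (intro eq_matI)
    fix i j assume "i < dim_row (det M \<cdot>\<^sub>m X)" "j < dim_col (det M \<cdot>\<^sub>m X)"
    then have i: "i < n" and j: "j = 0" by (auto simp: X_def)
    have "(M * U) $$ (i, j) = (M *\<^sub>v u) $ i"
      using i j M vecs by (auto simp: U_def scalar_prod_def intro!: sum.cong)
    then show "(M * U) $$ (i, j) = (det M \<cdot>\<^sub>m X) $$ (i, j)"
      using i j vecs by (simp add: u X_def)
  qed (use M in \<open>auto simp: defs\<close>)
  \<comment> \<open>\<open>?L\<close> clears the row \<open>Y\<close> by means of the corner 1 and
    leaves the Schur complement; \<open>?R\<close> below clears the column \<open>X\<close> by means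
    of \<open>M\<close>, at the price of a factor \<open>det M\<close>, which is cancelled at the
    end.\<close>
  have "?K * ?L = four_block_mat (1\<^sub>m 1) (0\<^sub>m 1 n) X (M - ?xy)"
    using carr M
    by (subst mult_four_block_mat[of _ 1 1 _ n _ n])
      (auto simp: scalar_prod_def defs intro!: cong_four_block_mat)
  moreover have "det ?L = 1"
    using carr by (subst det_four_block_mat_lower_left_zero[of _ 1 _ n]) auto
  moreover have "det (four_block_mat (1\<^sub>m 1) (0\<^sub>m 1 n) X (M - ?xy)) = det (M - ?xy)"
    using carr M by (subst det_four_block_mat_upper_right_zero[of _ 1 _ n]) auto
  ultimately have 1: "det ?K = det (M - ?xy)"
    using det_mult[OF K L] by simp
  have YU: "Y * U = (y \<bullet> u) \<cdot>\<^sub>m 1\<^sub>m 1"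
    using vecs by (intro eq_matI) (auto simp: defs scalar_prod_def)
  have "?K * ?R = four_block_mat ((det M - y \<bullet> u) \<cdot>\<^sub>m 1\<^sub>m 1) Y (0\<^sub>m n 1) M"
  proof -
    have "1\<^sub>m 1 * (det M \<cdot>\<^sub>m 1\<^sub>m 1) + Y * - U = (det M - y \<bullet> u) \<cdot>\<^sub>m 1\<^sub>m 1"
      using carr YU by (intro eq_matI) auto
    moreover have "X * (det M \<cdot>\<^sub>m 1\<^sub>m 1) + M * - U = 0\<^sub>m n 1"
      using carr M MU by (intro eq_matI) auto
    ultimately show ?thesis
      using carr M by (subst mult_four_block_mat[of _ 1 1 _ n _ n]) auto
  qed
  moreover have "det ?R = det M"
    using carr by (subst det_four_block_mat_upper_right_zero[of _ 1 _ n]) auto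
  moreover have "det (four_block_mat ((det M - y \<bullet> u) \<cdot>\<^sub>m 1\<^sub>m 1) Y (0\<^sub>m n 1) M)
      = (det M - y \<bullet> u) * det M"
    using carr M by (subst det_four_block_mat_lower_left_zero[of _ 1 _ n]) auto
  ultimately have 2: "det ?K * det M = (det M - y \<bullet> u) * det M"
    using det_mult[OF K R] by metis
  with det0 1 show ?thesis
    by simp
qed


section \<open>Polynomials annihilating the all-ones vector\<close>

lemma poly_of_mat_mult_vec:
  fixes A :: "'a :: comm_ring_1 mat"
  assumes A: "A \<in> carrier_mat n n" and v: "v \<in> carrier_vec n" and i: "i < n"
  shows "(poly_of_mat f A *\<^sub>v v) $ i = (\<Sum>k\<le>degree f. poly.coeff f k * (A ^\<^sub>m k *\<^sub>v v) $ i)"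
proof -
  have "(poly_of_mat f A *\<^sub>v v) $ i
      = (\<Sum>j<n. (\<Sum>k\<le>degree f. poly.coeff f k * (A ^\<^sub>m k) $$ (i, j)) * v $ j)"
    using A i by (subst mult_mat_vec_nth_sum[OF _ v i]) (auto simp: poly_of_mat_def)
  also have "\<dots> = (\<Sum>k\<le>degree f. \<Sum>j<n. poly.coeff f k * ((A ^\<^sub>m k) $$ (i, j) * v $ j))"
    by (subst sum.swap) (simp add: sum_distrib_right mult.assoc)
  also have "\<dots> = (\<Sum>k\<le>degree f. poly.coeff f k * (A ^\<^sub>m k *\<^sub>v v) $ i)"
    by (intro sum.cong refl)
      (subst mult_mat_vec_nth_sum[OF pow_carrier_mat[OF A] v i], simp add: sum_distrib_left)
  finally show ?thesis .
qed

text \<open>Allows summation beyond the degree: up to a common bound for several polynomials, or up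
  to the old degree when reduction modulo \<open>p\<close> lowers it.\<close>

lemma coeff_sum_degree_le:
  fixes f :: "'a :: comm_ring_1 poly"
  assumes "degree f \<le> m"
  shows "(\<Sum>k\<le>degree f. poly.coeff f k * g k) = (\<Sum>k\<le>m. poly.coeff f k * g k)"
  using assms by (intro sum.mono_neutral_left) (auto simp: coeff_eq_0)

text \<open>Comparing coefficients in \<open>(x I - A) v(x) = f(x) e\<close> makes \<open>f(A) e\<close> a telescoping sum,
  as in the proof of the Cayley-Hamilton theorem.\<close>

lemma poly_of_mat_mult_vec_eq_0:
  fixes A :: "'a :: comm_ring_1 mat"
  assumes A: "A \<in> carrier_mat n n" and e: "e \<in> carrier_vec n" and v: "v \<in> carrier_vec n"
    and eq: "char_poly_matrix A *\<^sub>v v = f \<cdot>\<^sub>v map_vec (\<lambda>a. [:a:]) e"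
  shows "poly_of_mat f A *\<^sub>v e = 0\<^sub>v n"
proof -
  define V where "V k = vec n (\<lambda>i. poly.coeff (v $ i) k)" for k
  have V: "V k \<in> carrier_vec n" for k
    by (simp add: V_def)
  have pow: "A ^\<^sub>m k \<in> carrier_mat n n" for k
    using A by simp
  \<comment> \<open>Coefficient of x^k in row \<open>i\<close> of the hypothesis, where
    \<open>V k\<close> collects the coefficients of x^k in \<open>v\<close>. The factor x shifts the
    index by one, so nothing comes from it at \<open>k = 0\<close>.\<close>
  have coeff: "poly.coeff f k * e $ i = (if k = 0 then 0 else V (k - 1) $ i) - (A *\<^sub>v V k) $ i"
    if i: "i < n" for i k
  proof -
    have "f * [:e $ i:] = (\<Sum>j<n. char_poly_matrix A $$ (i, j) * v $ j)"
      using arg_cong[OF eq, of "\<lambda>w. w $ i"] mult_mat_vec_nth_sum[OF char_poly_matrix_closed[OF A] v i]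
        i e by simp
    also have "\<dots> = (\<Sum>j<n. (if j = i then [:0, 1:] * v $ i else 0) - [:A $$ (i, j):] * v $ j)"
      using A i by (intro sum.cong) (auto simp: char_poly_matrix_def algebra_simps)
    also have "\<dots> = [:0, 1:] * v $ i - (\<Sum>j<n. [:A $$ (i, j):] * v $ j)"
      using i by (simp add: sum_subtractf)
    finally have "poly.coeff (f * [:e $ i:]) k
        = poly.coeff ([:0, 1:] * v $ i) k - (\<Sum>j<n. A $$ (i, j) * poly.coeff (v $ j) k)"
      by (simp add: coeff_sum)
    moreover have "(A *\<^sub>v V k) $ i = (\<Sum>j<n. A $$ (i, j) * poly.coeff (v $ j) k)"
      by (subst mult_mat_vec_nth_sum[OF A V i]) (simp add: V_def)
    ultimately show ?thesis
      using i by (cases k) (simp_all add: V_def mult.commute)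
  qed
  have coeff_vec: "poly.coeff f 0 \<cdot>\<^sub>v e = - (A *\<^sub>v V 0)"
    "poly.coeff f (Suc k) \<cdot>\<^sub>v e = V k - A *\<^sub>v V (Suc k)" for k
    using coeff[of _ 0] coeff[of _ "Suc k"] A V e by (auto intro!: eq_vecI)
  have powV: "A ^\<^sub>m k *\<^sub>v (A *\<^sub>v V l) = A ^\<^sub>m Suc k *\<^sub>v V l" for k l
    using assoc_mult_mat_vec[OF pow A V] by simp
  have tele: "(\<Sum>k\<le>m. poly.coeff f k * (A ^\<^sub>m k *\<^sub>v e) $ i) = - (A ^\<^sub>m Suc m *\<^sub>v V m) $ i"
    if i: "i < n" for i m
  proof (induction m)
    case 0
    have "poly.coeff f 0 * e $ i = (poly.coeff f 0 \<cdot>\<^sub>v e) $ i"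
      using i e by simp
    also have "\<dots> = - (A *\<^sub>v V 0) $ i"
      unfolding coeff_vec using i A by simp
    finally show ?case
      using A e by simp
  next
    case (Suc m)
    have "poly.coeff f (Suc m) * (A ^\<^sub>m Suc m *\<^sub>v e) $ i = (A ^\<^sub>m Suc m *\<^sub>v (poly.coeff f (Suc m) \<cdot>\<^sub>v e)) $ i"
      using i unfolding mult_mat_smult_vec[OF pow e]
      by (simp only: index_smult_vec(1) carrier_vecD[OF mult_mat_vec_carrier[OF pow e]])
    also have "\<dots> = (A ^\<^sub>m Suc m *\<^sub>v V m) $ i - (A ^\<^sub>m Suc m *\<^sub>v (A *\<^sub>v V (Suc m))) $ i"
      unfolding coeff_vec
      using i pow[of "Suc m"] A V by (subst mult_minus_distrib_mat_vec[OF pow V]) auto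
    also have "\<dots> = (A ^\<^sub>m Suc m *\<^sub>v V m) $ i - (A ^\<^sub>m Suc (Suc m) *\<^sub>v V (Suc m)) $ i"
      unfolding powV ..
    finally show ?case
      using Suc by simp
  qed
  \<comment> \<open>A bound for \<open>degree f\<close> that strictly exceeds all degrees in
    \<open>v\<close>, so that \<open>V m\<close> is zero and the boundary term of the telescoping
    sum disappears.\<close>
  define m where "m = Max (insert (degree f) ((\<lambda>i. Suc (degree (v $ i))) ` {..<n}))"
  have m: "degree f \<le> m" "degree (v $ i) < m" if "i < n" for i
    using that by (auto simp: m_def Suc_le_eq[symmetric])
  have Vm: "V m = 0\<^sub>v n"
    using m(2) by (auto simp: V_def intro!: eq_vecI coeff_eq_0)
  show ?thesis
  proof (intro eq_vecI)
    fix i assume "i < dim_vec (0\<^sub>v n :: 'a vec)"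
    then have i: "i < n" by simp
    have "(poly_of_mat f A *\<^sub>v e) $ i = (\<Sum>k\<le>m. poly.coeff f k * (A ^\<^sub>m k *\<^sub>v e) $ i)"
      unfolding poly_of_mat_mult_vec[OF A e i] by (rule coeff_sum_degree_le[OF m(1)[OF i]])
    also have "\<dots> = - (A ^\<^sub>m Suc m *\<^sub>v V m) $ i"
      by (rule tele[OF i])
    also have "\<dots> = 0"
      unfolding Vm mult_mat_vec_nth_sum[OF pow zero_carrier_vec i] by (auto intro!: sum.neutral)
    finally show "(poly_of_mat f A *\<^sub>v e) $ i = 0\<^sub>v n $ i"
      using i by simp
  qed (use A in \<open>simp add: poly_of_mat_def\<close>)
qed

section \<open>Square roots of polynomials and the relation \<open>f(A) e = 0\<close> over a
  field\<close>

text \<open>Multiplicities at each prime \<open>q\<close>: that of \<open>f\<close> is at most twice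
  that of \<open>u\<close>, and an integer that is at least half of a number is at least the
  rounded-up half.\<close>

lemma poly_sqrt_dvd:
  fixes f u :: "'a :: field_gcd poly"
  assumes f: "f \<noteq> 0" and dvd: "f dvd u\<^sup>2"
  shows "poly_sqrt f dvd u"
proof (cases "u = 0")
  case False
  have mult: "nat \<lceil>real (multiplicity q f) / 2\<rceil> \<le> multiplicity q u" if "prime q" for q
  proof -
    have "multiplicity q f \<le> multiplicity q (u\<^sup>2)"
      using dvd False that by (intro dvd_imp_multiplicity_le) auto
    also have "\<dots> = 2 * multiplicity q u"
      using that False by (intro prime_elem_multiplicity_power_distrib) auto
    finally have "real (multiplicity q f) / 2 \<le> real (multiplicity q u)"
      by simp
    then show ?thesis
      by (simp add: ceiling_le_iff nat_le_iff)
  qed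
  show ?thesis
  proof (rule multiplicity_le_imp_dvd)
    show "poly_sqrt f \<noteq> 0"
      by (auto simp: poly_sqrt_def)
    show "multiplicity q (poly_sqrt f) \<le> multiplicity q u" if "prime q" for q
      using mult[OF that] that unfolding poly_sqrt_def
      by (subst multiplicity_prod_prime_powers) auto
  qed
qed simp

lemma poly_sqrt_dvd_self: "f \<noteq> 0 \<Longrightarrow> poly_sqrt f dvd f"
  by (rule poly_sqrt_dvd) auto

lemma char_poly_neq_0: "A \<in> carrier_mat n n \<Longrightarrow> char_poly A \<noteq> 0"
  by (metis degree_monic_char_poly leading_coeff_0_iff zero_neq_one)

lemma annihilates_ones_vec:
  fixes A :: "'a :: field_gcd mat"
  assumes A: "A \<in> carrier_mat n n" and sym: "transpose_mat A = A"
  defines "\<Phi> \<equiv> gcd (char_poly A) (char_poly (A + ones_mat n))"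
  shows "poly_of_mat (char_poly A div poly_sqrt \<Phi>) A *\<^sub>v ones_vec n = 0\<^sub>v n"
proof (rule poly_of_mat_mult_vec_eq_0[OF A])
  define M where "M = char_poly_matrix A"
  define x where "x = (ones_vec n :: 'a poly vec)"
  have M: "M \<in> carrier_mat n n" and x: "x \<in> carrier_vec n"
    using A by (auto simp: M_def x_def ones_vec_def)
  have det: "char_poly A = det M"
    by (simp add: M_def char_poly_def)
  have det0: "det M \<noteq> 0"
    using char_poly_neq_0[OF A] by (simp add: det)
  have symM: "transpose_mat M = M"
  proof (intro eq_matI)
    fix i j assume "i < dim_row M" "j < dim_col M"
    with M have ij: "i < n" "j < n" by auto
    have "A $$ (j, i) = transpose_mat A $$ (i, j)"
      using A ij by simp
    then show "transpose_mat M $$ (i, j) = M $$ (i, j)"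
      using A ij by (auto simp: sym M_def char_poly_matrix_def)
  qed (use M in auto)
  define u where "u = Determinant.adj_mat M *\<^sub>v x"
  have u: "u \<in> carrier_vec n"
    using Determinant.adj_mat(1)[OF M] x by (simp add: u_def)
  have "M *\<^sub>v u = (M * Determinant.adj_mat M) *\<^sub>v x"
    using Determinant.adj_mat(1)[OF M] M x by (simp add: u_def)
  also have "\<dots> = det M \<cdot>\<^sub>v x"
    using Determinant.adj_mat(2)[OF M] x by (auto intro!: eq_vecI)
  finally have Mu: "M *\<^sub>v u = det M \<cdot>\<^sub>v x" .
  \<comment> \<open>Adding the all-ones matrix to \<open>A\<close> is a rank-one update of the
    characteristic matrix, so \<open>det_rank_one_update\<close> applies with both vectors equal to
    \<open>x\<close>.\<close>
  have "char_poly_matrix (A + ones_mat n) = M - mat n n (\<lambda>(i, j). x $ i * x $ j)"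
    using A by (intro eq_matI) (auto simp: char_poly_matrix_def M_def x_def ones_mat_def ones_vec_def one_pCons)
  then have "char_poly (A + ones_mat n) = det M - x \<bullet> u"
    using det_rank_one_update[OF M det0 x x u Mu] by (simp add: char_poly_def)
  then have \<Phi>_dvd: "\<Phi> dvd det M" "\<Phi> dvd x \<bullet> u"
    unfolding \<Phi>_def det by (simp, metis dvd_diff_right_iff gcd_dvd1 gcd_dvd2)
  have \<Phi>0: "\<Phi> \<noteq> 0"
    using \<Phi>_dvd(1) det0 by auto
  define s where "s = poly_sqrt \<Phi>"
  have s_u: "s dvd u $ i" if "i < n" for i
    unfolding s_def
    by (rule poly_sqrt_dvd[OF \<Phi>0 dvd_square_of_symmetric[OF M symM det0 x u Mu that \<Phi>_dvd]])
  have s_det: "s dvd det M"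
    using poly_sqrt_dvd_self[OF \<Phi>0] \<Phi>_dvd(1) unfolding s_def by (rule dvd_trans)
  with det0 have s0: "s \<noteq> 0" by auto
  \<comment> \<open>The witness for \<open>poly_of_mat_mult_vec_eq_0\<close>: the vector
    \<open>u\<close> divided exactly by \<open>s\<close>, which divides each of its entries.\<close>
  define v where "v = vec n (\<lambda>i. u $ i div s)"
  show v: "v \<in> carrier_vec n"
    by (simp add: v_def)
  have usv: "u = s \<cdot>\<^sub>v v"
    using u s_u by (auto simp: v_def intro!: eq_vecI)
  have "s \<cdot>\<^sub>v (M *\<^sub>v v) = s \<cdot>\<^sub>v ((det M div s) \<cdot>\<^sub>v x)"
    using Mu s_det M v by (simp add: usv mult_mat_smult_vec smult_smult_assoc)
  then have "M *\<^sub>v v = (det M div s) \<cdot>\<^sub>v x"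
    using s0 M v x by (auto simp: vec_eq_iff)
  moreover have "x = map_vec (\<lambda>a. [:a:]) (ones_vec n)"
    by (auto simp: x_def ones_vec_def one_pCons)
  ultimately show "char_poly_matrix A *\<^sub>v v
      = (char_poly A div poly_sqrt \<Phi>) \<cdot>\<^sub>v map_vec (\<lambda>a. [:a:]) (ones_vec n)"
    by (simp add: M_def[symmetric] det s_def)
qed (simp add: ones_vec_def)


section \<open>Smith normal form of a non-singular integer matrix\<close>

lemma invertible_mat_if_det_dvd_1:
  fixes U :: "'a :: comm_ring_1 mat"
  assumes U: "U \<in> carrier_mat n n" and det: "det U dvd 1"
  shows "invertible_mat U"
proof -
  from det obtain k where k: "1 = det U * k"
    by (elim dvdE)
  let ?B = "k \<cdot>\<^sub>m Determinant.adj_mat U"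
  note adj = Determinant.adj_mat[OF U]
  have "U * ?B = 1\<^sub>m n"
    using U adj(1) k by (subst mult_smult_distrib) (auto simp: adj(2) mult.commute intro!: eq_matI)
  moreover have "?B * U = 1\<^sub>m n"
    using U adj(1) k by (subst mult_smult_assoc_mat) (auto simp: adj(3) mult.commute intro!: eq_matI)
  ultimately show ?thesis
    using U adj(1) unfolding invertible_mat_def inverts_mat_def by auto
qed

text \<open>Unimodularity is expressed by the determinant, which is multiplicative, so products need
  no explicit inverses; \<open>invertible_mat_if_det_dvd_1\<close> supplies the inverses
  afterwards.\<close>

definition unimod_equiv :: "nat \<Rightarrow> 'a :: comm_ring_1 mat \<Rightarrow> 'a mat \<Rightarrow> bool" where
  "unimod_equiv n M N \<longleftrightarrow> (\<exists>U\<in>carrier_mat n n. \<exists>V\<in>carrier_mat n n.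
     det U dvd 1 \<and> det V dvd 1 \<and> N = U * M * V)"

lemma unimod_equiv_refl: "M \<in> carrier_mat n n \<Longrightarrow> unimod_equiv n M M"
  unfolding unimod_equiv_def by (rule bexI[of _ "1\<^sub>m n"], rule bexI[of _ "1\<^sub>m n"]) auto

lemma unimod_equiv_carrier: "M \<in> carrier_mat n n \<Longrightarrow> unimod_equiv n M N \<Longrightarrow> N \<in> carrier_mat n n"
  by (auto simp: unimod_equiv_def)

lemma unimod_equiv_mult:
  fixes M :: "'a :: comm_ring_1 mat"
  assumes M: "M \<in> carrier_mat n n" and eq: "unimod_equiv n M N"
    and P: "P \<in> carrier_mat n n" "det P dvd 1"
  shows "unimod_equiv n M (P * N)" "unimod_equiv n M (N * P)"
proof -
  from eq obtain U V where UV: "U \<in> carrier_mat n n" "V \<in> carrier_mat n n" "det U dvd 1" "det V dvd 1"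
    and N: "N = U * M * V"
    by (auto simp: unimod_equiv_def)
  have "P * N = (P * U) * M * V"
    using UV P M by (simp add: N assoc_mult_mat[of _ n n _ n _ n])
  moreover have "det (P * U) dvd 1"
    using UV P by (simp add: det_mult)
  ultimately show "unimod_equiv n M (P * N)"
    using UV P unfolding unimod_equiv_def by (intro bexI[of _ "P * U"] bexI[of _ V]) auto
  have "N * P = U * M * (V * P)"
    using UV P M by (simp add: N assoc_mult_mat[of _ n n _ n _ n])
  moreover have "det (V * P) dvd 1"
    using UV P by (simp add: det_mult)
  ultimately show "unimod_equiv n M (N * P)"
    using UV P unfolding unimod_equiv_def by (intro bexI[of _ U] bexI[of _ "V * P"]) auto
qed

text \<open>One step of Euclid's algorithm: subtract the quotient times row 0 from row
  \<open>i\<close>, then swap the two rows to bring the remainder into the corner.\<close>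

lemma pivot_mod_row_operation:
  fixes N :: "int mat"
  assumes N: "N \<in> carrier_mat n n" and i: "i < n" "i \<noteq> 0"
  obtains P where "P \<in> carrier_mat n n" "det P dvd 1"
    "(P * N) $$ (0, 0) = N $$ (i, 0) mod N $$ (0, 0)"
proof
  define q where "q = N $$ (i, 0) div N $$ (0, 0)"
  let ?P = "swaprows_mat n 0 i * addrow_mat n (- q) i 0"
  show "?P \<in> carrier_mat n n" by auto
  have "det ?P = - 1"
    using i by (subst det_mult[of _ n]) (auto simp: det_swaprows_mat det_addrow_mat)
  then show "det ?P dvd 1"
    by simp
  have "?P * N = swaprows_mat n 0 i * (addrow_mat n (- q) i 0 * N)"
    using N by (intro assoc_mult_mat[of _ n n _ n _ n]) auto
  also have "addrow_mat n (- q) i 0 * N = addrow (- q) i 0 N"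
    using i by (intro addrow_mat[OF N, symmetric]) auto
  also have "swaprows_mat n 0 i * \<dots> = swaprows 0 i (addrow (- q) i 0 N)"
    using i N by (intro swaprows_mat[symmetric, of _ n n]) auto
  finally show "(?P * N) $$ (0, 0) = N $$ (i, 0) mod N $$ (0, 0)"
    using i N by (simp add: q_def minus_div_mult_eq_mod[symmetric])
qed

section \<open>Minimal pivots and existence of the Smith normal form\<close>

text \<open>Minimality over the whole equivalence class replaces a termination argument for
  elimination. Up to sign, such a corner is the first invariant factor.\<close>

definition smith_pivot :: "nat \<Rightarrow> int mat \<Rightarrow> int mat \<Rightarrow> bool" where
  "smith_pivot n M N \<longleftrightarrow> unimod_equiv n M N \<and> N $$ (0, 0) \<noteq> 0 \<and>
     (\<forall>N'. unimod_equiv n M N' \<longrightarrow> N' $$ (0, 0) \<noteq> 0 \<longrightarrow> \<bar>N $$ (0, 0)\<bar> \<le> \<bar>N' $$ (0, 0)\<bar>)"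

text \<open>A nonzero remainder modulo the corner could be moved into the corner, contradicting
  minimality. For row 0 the row operation is carried out on the transpose.\<close>

lemma smith_pivot_dvd_border:
  assumes M: "M \<in> carrier_mat n n" and piv: "smith_pivot n M N" and i: "i < n"
  shows "N $$ (0, 0) dvd N $$ (i, 0)" "N $$ (0, 0) dvd N $$ (0, i)"
proof -
  from piv have eq: "unimod_equiv n M N" and N0: "N $$ (0, 0) \<noteq> 0"
    by (auto simp: smith_pivot_def)
  note N = unimod_equiv_carrier[OF M eq]
  have dvd: "N $$ (0, 0) dvd x" if "unimod_equiv n M N'" "N' $$ (0, 0) = x mod N $$ (0, 0)" for N' x
  proof (rule ccontr)
    assume "\<not> N $$ (0, 0) dvd x"
    then have "N' $$ (0, 0) \<noteq> 0"
      by (simp add: that(2) dvd_eq_mod_eq_0)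
    with piv that(1) have "\<bar>N $$ (0, 0)\<bar> \<le> \<bar>N' $$ (0, 0)\<bar>"
      by (auto simp: smith_pivot_def)
    with abs_mod_less[OF N0, of x] show False
      by (simp add: that(2))
  qed
  show "N $$ (0, 0) dvd N $$ (i, 0)"
  proof (cases "i = 0")
    case False
    from pivot_mod_row_operation[OF N i this] obtain P where "P \<in> carrier_mat n n" "det P dvd 1"
      "(P * N) $$ (0, 0) = N $$ (i, 0) mod N $$ (0, 0)" .
    then show ?thesis
      using dvd unimod_equiv_mult(1)[OF M eq] by blast
  qed simp
  show "N $$ (0, 0) dvd N $$ (0, i)"
  proof (cases "i = 0")
    case False
    have NT: "transpose_mat N \<in> carrier_mat n n"
      using N by simp
    from pivot_mod_row_operation[OF NT i False] obtain P where P: "P \<in> carrier_mat n n" "det P dvd 1"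
      and PN: "(P * transpose_mat N) $$ (0, 0) = transpose_mat N $$ (i, 0) mod transpose_mat N $$ (0, 0)" .
    have "P * transpose_mat N = transpose_mat (N * transpose_mat P)"
      using P N by (simp add: transpose_mult[of _ n n _ n])
    with PN have "(N * transpose_mat P) $$ (0, 0) = N $$ (0, i) mod N $$ (0, 0)"
      using i N P by simp
    moreover have "unimod_equiv n M (N * transpose_mat P)"
      using P by (intro unimod_equiv_mult(2)[OF M eq]) (auto simp: det_transpose)
    ultimately show ?thesis
      by (rule dvd[rotated])
  qed simp
qed

text \<open>Clearing entry (i, 0) and then adding row \<open>i\<close> to row 0 keeps the corner, so
  \<open>N'\<close> is again a pivot matrix. Its row 0 contains the entry (i, j) up to multiples of
  the old row 0, and the border case applies.\<close>

lemma smith_pivot_dvd: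
  assumes M: "M \<in> carrier_mat n n" and piv: "smith_pivot n M N" and ij: "i < n" "j < n"
  shows "N $$ (0, 0) dvd N $$ (i, j)"
proof (cases "i = 0")
  case False
  from piv have eq: "unimod_equiv n M N"
    by (auto simp: smith_pivot_def)
  note N = unimod_equiv_carrier[OF M eq]
  from smith_pivot_dvd_border(1)[OF M piv ij(1)] obtain a where a: "N $$ (i, 0) = N $$ (0, 0) * a"
    by (elim dvdE)
  define N' where "N' = addrow 1 0 i (addrow (- a) i 0 N)"
  have "addrow (- a) i 0 N = addrow_mat n (- a) i 0 * N"
    using ij by (intro addrow_mat[OF N]) auto
  then have N'_eq: "N' = addrow_mat n 1 0 i * (addrow_mat n (- a) i 0 * N)"
    unfolding N'_def using N ij
    by (simp only:, intro addrow_mat[of _ n n]) auto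
  have "unimod_equiv n M N'"
    unfolding N'_eq using False
    by (intro unimod_equiv_mult(1)[OF M] eq) (auto simp: det_addrow_mat)
  moreover have N'00: "N' $$ (0, 0) = N $$ (0, 0)"
    using N ij False a by (simp add: N'_def)
  ultimately have "smith_pivot n M N'"
    using piv by (simp add: smith_pivot_def)
  from smith_pivot_dvd_border(2)[OF M this ij(2)]
  have "N $$ (0, 0) dvd (N $$ (i, j) - a * N $$ (0, j)) + N $$ (0, j)"
    unfolding N'00 using N ij False by (simp add: N'_def)
  with smith_pivot_dvd_border(2)[OF M piv ij(2)] show ?thesis
    by (metis dvd_add_left_iff dvd_diff_left_iff dvd_mult)
qed (use smith_pivot_dvd_border(2)[OF M piv] ij in simp)

text \<open>Some entry is nonzero because the determinant is; two swaps bring it into the corner,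
  and well-ordering then picks a corner of least absolute value.\<close>

lemma smith_pivot_exists:
  assumes M: "M \<in> carrier_mat n n" and det0: "det M \<noteq> 0" and n: "0 < n"
  obtains N where "smith_pivot n M N"
proof -
  have "\<exists>i<n. \<exists>j<n. M $$ (i, j) \<noteq> 0"
  proof (rule ccontr)
    assume "\<not> ?thesis"
    then have "M = 0 \<cdot>\<^sub>m M"
      using M by (intro eq_matI) auto
    then have "det M = 0 ^ n * det M"
      using M by (metis carrier_matD(2) det_smult)
    with det0 n show False
      by (simp add: zero_power)
  qed
  then obtain i j where ij: "i < n" "j < n" "M $$ (i, j) \<noteq> 0"
    by blast
  define M1 where "M1 = (if i = 0 then M else swaprows_mat n 0 i * M)"
  have eq1: "unimod_equiv n M M1"
    using unimod_equiv_mult(1)[OF M unimod_equiv_refl[OF M], of "swaprows_mat n 0 i"]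
      unimod_equiv_refl[OF M] ij n by (auto simp: M1_def det_swaprows_mat)
  have M1: "M1 \<in> carrier_mat n n" and M1_0j: "M1 $$ (0, j) = M $$ (i, j)"
    using M ij n by (auto simp: M1_def swaprows_mat[symmetric, of _ n n])
  define M2 where "M2 = (if j = 0 then M1 else M1 * swaprows_mat n 0 j)"
  have eq2: "unimod_equiv n M M2"
    using unimod_equiv_mult(2)[OF M eq1, of "swaprows_mat n 0 j"]
      eq1 ij n by (auto simp: M2_def det_swaprows_mat)
  have "M2 $$ (0, 0) = M $$ (i, j)"
    using M1 ij n M1_0j by (auto simp: M2_def swapcols_mat[symmetric, of _ n n])
  with eq2 ij have "unimod_equiv n M M2 \<and> M2 $$ (0, 0) \<noteq> 0"
    by simp
  from ex_has_least_nat[of "\<lambda>N. unimod_equiv n M N \<and> N $$ (0, 0) \<noteq> 0", OF this,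
      of "\<lambda>N. nat \<bar>N $$ (0, 0)\<bar>"]
  show ?thesis
    using that by (auto simp: smith_pivot_def nat_le_eq_zle)
qed

text \<open>Induction on the size: the pivot divides every entry, so its row and column can be
  cleared, and it divides every invariant factor of the remaining block.\<close>

lemma smith_normal_form_exists_aux:
  fixes M :: "int mat"
  assumes "M \<in> carrier_mat n n" "det M \<noteq> 0"
  shows "\<exists>D. unimod_equiv n M D \<and> diagonal_mat D \<and> (\<forall>i<n. 0 < D $$ (i, i)) \<and>
    (\<forall>i. Suc i < n \<longrightarrow> D $$ (i, i) dvd D $$ (Suc i, Suc i))"
  using assms
proof (induction n arbitrary: M)
  case 0
  then show ?case
    using unimod_equiv_refl by (intro exI[of _ M]) (auto simp: diagonal_mat_def)
next
  case (Suc m)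
  note M = Suc.prems(1)
  from smith_pivot_exists[OF Suc.prems] obtain N where piv: "smith_pivot (Suc m) M N"
    by blast
  from piv have eq: "unimod_equiv (Suc m) M N" and N0: "N $$ (0, 0) \<noteq> 0"
    by (auto simp: smith_pivot_def)
  note N = unimod_equiv_carrier[OF M eq]
  define d where "d = N $$ (0, 0)"
  have d_dvd: "d dvd N $$ (i, j)" if "i < Suc m" "j < Suc m" for i j
    unfolding d_def by (rule smith_pivot_dvd[OF M piv that])
  define b where "b = mat 1 m (\<lambda>(i, j). N $$ (0, Suc j) div d)"
  define c where "c = mat m 1 (\<lambda>(i, j). N $$ (Suc i, 0) div d)"
  define N1 where "N1 = mat m m (\<lambda>(i, j). N $$ (Suc i, Suc j))"
  have carr: "b \<in> carrier_mat 1 m" "c \<in> carrier_mat m 1" "N1 \<in> carrier_mat m m"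
    by (auto simp: b_def c_def N1_def)
  have N_block: "N = four_block_mat (d \<cdot>\<^sub>m 1\<^sub>m 1) (d \<cdot>\<^sub>m b) (d \<cdot>\<^sub>m c) N1"
    using N d_dvd by (intro eq_matI) (auto simp: b_def c_def N1_def d_def less_Suc_eq_0_disj)
  \<comment> \<open>\<open>L\<close> and \<open>R\<close> clear the border; the factor
    \<open>sgn d\<close> makes the corner positive.\<close>
  define L where "L = four_block_mat (sgn d \<cdot>\<^sub>m 1\<^sub>m 1) (0\<^sub>m 1 m) (- c) (1\<^sub>m m)"
  define R where "R = four_block_mat (1\<^sub>m 1) (- b) (0\<^sub>m m 1) (1\<^sub>m m)"
  define N2 where "N2 = N1 - d \<cdot>\<^sub>m (c * b)"
  have L: "L \<in> carrier_mat (Suc m) (Suc m)" and R: "R \<in> carrier_mat (Suc m) (Suc m)"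
    and N2: "N2 \<in> carrier_mat m m"
    using carr by (auto simp: L_def R_def N2_def)
  have detL: "det L dvd 1"
    unfolding L_def using carr N0
    by (subst det_four_block_mat_upper_right_zero[of _ 1 _ m]) (auto simp: d_def sgn_if)
  have detR: "det R dvd 1"
    unfolding R_def using carr by (subst det_four_block_mat_lower_left_zero[of _ 1 _ m]) auto
  have "L * N = four_block_mat (\<bar>d\<bar> \<cdot>\<^sub>m 1\<^sub>m 1) (\<bar>d\<bar> \<cdot>\<^sub>m b) (0\<^sub>m m 1) N2"
    unfolding L_def N_block
    using carr by (subst mult_four_block_mat[of _ 1 1 _ m _ m _ _ 1 _ m])
      (auto simp: N2_def abs_sgn mult.commute scalar_prod_def intro!: cong_four_block_mat eq_matI)
  then have LNR: "L * N * R = four_block_mat (\<bar>d\<bar> \<cdot>\<^sub>m 1\<^sub>m 1) (0\<^sub>m 1 m) (0\<^sub>m m 1) N2"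
    unfolding R_def
    using carr N2 by (simp, subst mult_four_block_mat[of _ 1 1 _ m _ m _ _ 1 _ m])
      (auto simp: scalar_prod_def intro!: cong_four_block_mat eq_matI)
  have eq2: "unimod_equiv (Suc m) M (L * N * R)"
    by (intro unimod_equiv_mult[OF M] eq L R detL detR)
  then have "det (L * N * R) \<noteq> 0"
    using Suc.prems by (auto simp: unimod_equiv_def det_mult[of _ "Suc m"])
  then have "det N2 \<noteq> 0"
    unfolding LNR using N2 by (subst (asm) det_four_block_mat_upper_right_zero[of _ 1 _ m]) auto
  from Suc.IH[OF N2 this] obtain D where D: "unimod_equiv m N2 D" "diagonal_mat D"
    "\<And>i. i < m \<Longrightarrow> 0 < D $$ (i, i)" "\<And>i. Suc i < m \<Longrightarrow> D $$ (i, i) dvd D $$ (Suc i, Suc i)"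
    by blast
  note Dc = unimod_equiv_carrier[OF N2 D(1)]
  from D(1) obtain U V where U: "U \<in> carrier_mat m m" "det U dvd 1"
    and V: "V \<in> carrier_mat m m" "det V dvd 1" and D_eq: "D = U * N2 * V"
    by (auto simp: unimod_equiv_def)
  \<comment> \<open>Factoring \<open>d\<close> out of \<open>N2\<close> shows that \<open>d\<close>
    divides all diagonal entries of \<open>D\<close>, which gives the first link of the divisibility
    chain of \<open>D'\<close>.\<close>
  define N3 where "N3 = map_mat (\<lambda>x. x div d) N2"
  have "N2 = d \<cdot>\<^sub>m N3"
    using carr d_dvd by (intro eq_matI) (auto simp: N3_def N2_def N1_def right_diff_distrib)
  moreover have N3: "N3 \<in> carrier_mat m m"
    using N2 by (simp add: N3_def)
  ultimately have "D = d \<cdot>\<^sub>m (U * N3 * V)"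
    using mult_smult_distrib[OF U(1) N3, of d]
      mult_smult_assoc_mat[OF mult_carrier_mat[OF U(1) N3] V(1), of d]
    unfolding D_eq by metis
  then have d_D: "d dvd D $$ (i, i)" if "i < m" for i
    using that U V by simp
  define U' where "U' = four_block_mat (1\<^sub>m 1) (0\<^sub>m 1 m) (0\<^sub>m m 1) U"
  define V' where "V' = four_block_mat (1\<^sub>m 1) (0\<^sub>m 1 m) (0\<^sub>m m 1) V"
  define D' where "D' = four_block_mat (\<bar>d\<bar> \<cdot>\<^sub>m 1\<^sub>m 1) (0\<^sub>m 1 m) (0\<^sub>m m 1) D"
  have U': "U' \<in> carrier_mat (Suc m) (Suc m)" and V': "V' \<in> carrier_mat (Suc m) (Suc m)"
    using U V by (auto simp: U'_def V'_def)
  have det': "det U' dvd 1" "det V' dvd 1"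
    unfolding U'_def V'_def
    using U V by (auto simp: det_four_block_mat_upper_right_zero[of _ 1 _ m])
  have "U' * (L * N * R) * V' = D'"
    unfolding LNR U'_def V'_def D'_def D_eq
    using U V N2 by (simp add: mult_four_block_mat[of _ 1 1 _ m _ m _ _ 1 _ m])
  then have "unimod_equiv (Suc m) M D'"
    using unimod_equiv_mult(2)[OF M unimod_equiv_mult(1)[OF M eq2 U' det'(1)] V' det'(2)] by simp
  moreover have "diagonal_mat D'"
    using D(2) Dc by (auto simp: diagonal_mat_def D'_def)
  moreover have "0 < D' $$ (i, i)" if "i < Suc m" for i
    using that D(3) N0 Dc by (cases i) (auto simp: D'_def d_def)
  moreover have "D' $$ (i, i) dvd D' $$ (Suc i, Suc i)" if "Suc i < Suc m" for i
    using that D(4) d_D Dc by (cases i) (auto simp: D'_def)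
  ultimately show ?case
    by blast
qed

lemma smith_normal_form_exists:
  assumes M: "M \<in> carrier_mat n n" and det0: "det M \<noteq> 0"
  obtains D where "smith_normal_form M D"
proof -
  from smith_normal_form_exists_aux[OF assms] obtain D where D: "unimod_equiv n M D" "diagonal_mat D"
    "\<forall>i<n. 0 < D $$ (i, i)" "\<forall>i. Suc i < n \<longrightarrow> D $$ (i, i) dvd D $$ (Suc i, Suc i)"
    by blast
  from D(1) obtain U V where "U \<in> carrier_mat n n" "V \<in> carrier_mat n n"
    "det U dvd 1" "det V dvd 1" "D = U * M * V"
    by (auto simp: unimod_equiv_def)
  with M D unimod_equiv_carrier[OF M D(1)] have "smith_normal_form M D"
    unfolding smith_normal_form_def
    by (intro exI[of _ n] conjI bexI[of _ U] bexI[of _ V]) (auto intro: invertible_mat_if_det_dvd_1)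
  then show ?thesis
    by (rule that)
qed

text \<open>The multiples of the last invariant factor are the integers \<open>k\<close> such that \<open>k M\<inverse>\<close> is
  integral; this makes it independent of the chosen normal form.\<close>

lemma smith_normal_form_last:
  fixes M :: "int mat"
  assumes snf: "smith_normal_form M D" and M: "M \<in> carrier_mat n n" and n: "0 < n"
  shows "0 < D $$ (dim_row D - 1, dim_row D - 1)"
    and "D $$ (dim_row D - 1, dim_row D - 1) dvd k
      \<longleftrightarrow> (\<exists>X\<in>carrier_mat n n. M * X = k \<cdot>\<^sub>m 1\<^sub>m n)"
proof -
  from snf M obtain U V where D: "D \<in> carrier_mat n n"
    and U: "U \<in> carrier_mat n n" "invertible_mat U" and V: "V \<in> carrier_mat n n" "invertible_mat V"
    and D_eq: "D = U * M * V" and diag: "diagonal_mat D"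
    and pos: "\<And>i. i < n \<Longrightarrow> 0 < D $$ (i, i)"
    and chain: "\<And>i. Suc i < n \<Longrightarrow> D $$ (i, i) dvd D $$ (Suc i, Suc i)"
    unfolding smith_normal_form_def by auto
  obtain U' where U': "U' \<in> carrier_mat n n" "U * U' = 1\<^sub>m n" "U' * U = 1\<^sub>m n"
    using U unfolding invertible_mat_def inverts_mat_def
    by (metis carrier_matD carrier_matI index_mult_mat(2,3) index_one_mat(2,3))
  obtain V' where V': "V' \<in> carrier_mat n n" "V * V' = 1\<^sub>m n" "V' * V = 1\<^sub>m n"
    using V unfolding invertible_mat_def inverts_mat_def
    by (metis carrier_matD carrier_matI index_mult_mat(2,3) index_one_mat(2,3))
  define d where "d = D $$ (n - 1, n - 1)"
  have last: "D $$ (dim_row D - 1, dim_row D - 1) = d"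
    using D by (simp add: d_def)
  show "0 < D $$ (dim_row D - 1, dim_row D - 1)"
    unfolding last d_def using pos n by simp
  have dvd_d: "D $$ (i, i) dvd d" if "i < n" for i
  proof -
    have "i \<le> n - 1" using that by simp
    then show ?thesis
      unfolding d_def
    proof (induction rule: inc_induct)
      case (step k)
      then show ?case using chain[of k] by (auto intro: dvd_trans)
    qed simp
  qed
  have diag_mult: "(D * Y) $$ (i, j) = D $$ (i, i) * Y $$ (i, j)"
    if "Y \<in> carrier_mat n n" "i < n" "j < n" for Y i j
  proof -
    have "(D * Y) $$ (i, j) = (\<Sum>l = 0..<n. D $$ (i, l) * Y $$ (l, j))"
      using that D by (auto simp: scalar_prod_def)
    also have "\<dots> = (\<Sum>l = 0..<n. if l = i then D $$ (i, i) * Y $$ (i, j) else 0)"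
      using that D diag by (intro sum.cong) (auto simp: diagonal_mat_def)
    finally show ?thesis
      using that by simp
  qed
  have M_eq: "U' * D * V' = M"
  proof -
    have "U' * D * V' = (U' * U) * M * (V * V')"
      using U(1) V(1) U'(1) V'(1) M by (simp add: D_eq assoc_mult_mat[of _ n n _ n _ n])
    with M show ?thesis
      by (simp add: U'(3) V'(2))
  qed
  show "D $$ (dim_row D - 1, dim_row D - 1) dvd k
      \<longleftrightarrow> (\<exists>X\<in>carrier_mat n n. M * X = k \<cdot>\<^sub>m 1\<^sub>m n)"
    unfolding last
  proof
    assume "d dvd k"
    \<comment> \<open>This is \<open>k\<close> times the inverse of \<open>D\<close>; it is integral
      because each diagonal entry divides \<open>d\<close> and \<open>d\<close> divides
      \<open>k\<close>.\<close>
    define Y where "Y = mat n n (\<lambda>(i, j). if i = j then k div D $$ (i, i) else 0)"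
    have Y: "Y \<in> carrier_mat n n"
      by (simp add: Y_def)
    have DY: "D * Y = k \<cdot>\<^sub>m 1\<^sub>m n"
    proof (intro eq_matI)
      fix i j assume "i < dim_row (k \<cdot>\<^sub>m 1\<^sub>m n)" "j < dim_col (k \<cdot>\<^sub>m 1\<^sub>m n :: int mat)"
      then have ij: "i < n" "j < n" by auto
      have "D $$ (i, i) dvd k"
        using dvd_d[OF ij(1)] \<open>d dvd k\<close> by (rule dvd_trans)
      then show "(D * Y) $$ (i, j) = (k \<cdot>\<^sub>m 1\<^sub>m n) $$ (i, j)"
        using ij by (simp add: diag_mult[OF Y ij]) (auto simp: Y_def)
    qed (use D Y in auto)
    have "M * (V * Y * U) = U' * D * (V' * V) * Y * U"
      using U(1) V(1) U'(1) V'(1) D Y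
      by (simp add: M_eq[symmetric] assoc_mult_mat[of _ n n _ n _ n])
    also have "\<dots> = U' * (D * Y) * U"
      using U'(1) U(1) D Y by (simp add: V'(3) assoc_mult_mat[of _ n n _ n _ n])
    also have "\<dots> = k \<cdot>\<^sub>m 1\<^sub>m n"
      using U'(1) U(1) by (simp add: DY mult_smult_distrib[of _ n n _ n] mult_smult_assoc_mat[of _ n n _ n] U'(3))
    finally show "\<exists>X\<in>carrier_mat n n. M * X = k \<cdot>\<^sub>m 1\<^sub>m n"
      using U(1) V(1) Y by (intro bexI[of _ "V * Y * U"]) auto
  next
    assume "\<exists>X\<in>carrier_mat n n. M * X = k \<cdot>\<^sub>m 1\<^sub>m n"
    then obtain X where X: "X \<in> carrier_mat n n" "M * X = k \<cdot>\<^sub>m 1\<^sub>m n"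
      by blast
    have Y: "V' * X * U' \<in> carrier_mat n n"
      using V' X U' by auto
    have "D * (V' * X * U') = U * M * (V * V') * X * U'"
      using U(1) V(1) U'(1) V'(1) M X(1) by (simp add: D_eq assoc_mult_mat[of _ n n _ n _ n])
    also have "\<dots> = U * (M * X) * U'"
      using U(1) U'(1) M X(1) by (simp add: V'(2) assoc_mult_mat[of _ n n _ n _ n])
    also have "\<dots> = k \<cdot>\<^sub>m 1\<^sub>m n"
      using U'(1) U(1) by (simp add: X(2) mult_smult_distrib[of _ n n _ n] mult_smult_assoc_mat[of _ n n _ n] U'(2))
    \<comment> \<open>The last diagonal entry of this product is \<open>d\<close> times an
      integer.\<close>
    finally have "(D * (V' * X * U')) $$ (n - 1, n - 1) = k"
      using n by simp
    then have "k = d * (V' * X * U') $$ (n - 1, n - 1)"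
      using diag_mult[OF Y, of "n - 1" "n - 1"] n by (simp add: d_def)
    then show "d dvd k"
      by (rule dvdI)
  qed
qed

text \<open>The last entries of any two normal forms are positive and have the same multiples by
  \<open>smith_normal_form_last\<close>, so they agree and the definite description is meaningful.
  Taking \<open>k\<close> to be this number yields \<open>X\<close>.\<close>

lemma last_invariant_factor:
  fixes M :: "int mat"
  assumes M: "M \<in> carrier_mat n n" and det0: "det M \<noteq> 0" and n: "0 < n"
  shows "0 < last_invariant_factor M"
    and "\<exists>X\<in>carrier_mat n n. M * X = last_invariant_factor M \<cdot>\<^sub>m 1\<^sub>m n"
proof -
  from smith_normal_form_exists[OF M det0] obtain D where D: "smith_normal_form M D" .
  let ?d = "D $$ (dim_row D - 1, dim_row D - 1)"
  note last = smith_normal_form_last[OF _ M n]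
  have "last_invariant_factor M = ?d"
    unfolding last_invariant_factor_def
  proof (rule the_equality)
    fix d' assume "\<exists>D'. smith_normal_form M D' \<and> d' = D' $$ (dim_row D' - 1, dim_row D' - 1)"
    then obtain D' where D': "smith_normal_form M D'" "d' = D' $$ (dim_row D' - 1, dim_row D' - 1)"
      by blast
    have "?d dvd k \<longleftrightarrow> d' dvd k" for k
      unfolding D'(2) by (simp only: last(2)[OF D, of k] last(2)[OF D'(1), of k])
    from this[of ?d] this[of d'] have "d' dvd ?d" "?d dvd d'"
      by simp_all
    moreover have "0 \<le> d'" "0 \<le> ?d"
      unfolding D'(2) using last(1)[OF D] last(1)[OF D'(1)] by simp_all
    ultimately show "d' = ?d"
      by (intro zdvd_antisym_nonneg)
  qed (use D in blast)
  then show "0 < last_invariant_factor M"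
    "\<exists>X\<in>carrier_mat n n. M * X = last_invariant_factor M \<cdot>\<^sub>m 1\<^sub>m n"
    using last(1)[OF D] last(2)[OF D, of ?d] by auto
qed


section \<open>Reduced walk matrices and the level\<close>

text \<open>\<open>walk_mat\<close> takes an edge set; this version also covers the integer matrix
  \<open>Q^T A Q\<close> and the rational images of integer matrices.\<close>

definition krylov_mat :: "nat \<Rightarrow> 'a :: comm_ring_1 mat \<Rightarrow> 'a mat" where
  "krylov_mat n A = mat n n (\<lambda>(i, k). (A ^\<^sub>m k *\<^sub>v ones_vec n) $ i)"

text \<open>The coefficients of \<open>1, x, \<dots>, x ^ (r - 1), f, x f, \<dots>, x ^ (n - 1 - r) f\<close>,
  where \<open>r = degree f\<close>.\<close>

definition shift_mat :: "nat \<Rightarrow> 'a :: comm_ring_1 poly \<Rightarrow> 'a mat" where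
  "shift_mat n f = mat n n (\<lambda>(k, j). if j < degree f then (if k = j then 1 else 0)
     else if k < j - degree f then 0 else poly.coeff f (k - (j - degree f)))"

lemma ones_vec_carrier: "ones_vec n \<in> carrier_vec n"
  by (simp add: ones_vec_def)

lemma ones_mat_carrier: "ones_mat n \<in> carrier_mat n n"
  by (simp add: ones_mat_def)

lemma krylov_mat_carrier: "krylov_mat n A \<in> carrier_mat n n"
  by (simp add: krylov_mat_def)

lemma shift_mat_carrier: "shift_mat n f \<in> carrier_mat n n"
  by (simp add: shift_mat_def)

text \<open>The matrix is upper triangular, with diagonal entries 1 and the leading coefficient of
  \<open>f\<close>.\<close>

lemma det_shift_mat_neq_0:
  fixes f :: "'a :: idom poly"
  assumes "f \<noteq> 0"
  shows "det (shift_mat n f) \<noteq> 0"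
proof -
  have "upper_triangular (shift_mat n f)"
    by (auto simp: upper_triangular_def shift_mat_def intro!: coeff_eq_0)
  then have "det (shift_mat n f) = prod_list (diag_mat (shift_mat n f))"
    using shift_mat_carrier by (rule det_upper_triangular)
  moreover have "0 \<notin> set (diag_mat (shift_mat n f))"
    using assms by (auto simp: diag_mat_def shift_mat_def split: if_splits)
  ultimately show ?thesis
    by (simp add: prod_list_zero_iff)
qed

lemma pow_mat_add_mult_vec:
  fixes A :: "'a :: comm_ring_1 mat"
  assumes A: "A \<in> carrier_mat n n" and v: "v \<in> carrier_vec n"
  shows "A ^\<^sub>m j *\<^sub>v (A ^\<^sub>m k *\<^sub>v v) = A ^\<^sub>m (j + k) *\<^sub>v v"
proof -
  have "A ^\<^sub>m j * A ^\<^sub>m k = A ^\<^sub>m (j + k)"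
  proof (induction k)
    case (Suc k)
    have "A ^\<^sub>m j * A ^\<^sub>m Suc k = (A ^\<^sub>m j * A ^\<^sub>m k) * A"
      using assoc_mult_mat[OF pow_carrier_mat[OF A] pow_carrier_mat[OF A] A, of j k] by simp
    with Suc show ?case
      by simp
  qed (use A in simp)
  then show ?thesis
    using assoc_mult_mat_vec[OF pow_carrier_mat[OF A] pow_carrier_mat[OF A] v, of j k] by simp
qed

text \<open>A column of coefficients multiplied by the Krylov matrix is the corresponding polynomial
  in \<open>A\<close> applied to the all-ones vector.\<close>

lemma krylov_mat_mult_shift_mat:
  fixes A :: "'a :: comm_ring_1 mat"
  assumes A: "A \<in> carrier_mat n n" and ij: "i < n" "j < n"
  shows "(krylov_mat n A * shift_mat n f) $$ (i, j) =
    (if j < degree f then (A ^\<^sub>m j *\<^sub>v ones_vec n) $ i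
     else ((A ^\<^sub>m (j - degree f) * poly_of_mat f A) *\<^sub>v ones_vec n) $ i)"
proof -
  define m where "m = j - degree f"
  define e where "e = (ones_vec n :: 'a vec)"
  define g where "g k = (A ^\<^sub>m k *\<^sub>v e) $ i" for k
  have e: "e \<in> carrier_vec n"
    by (simp add: e_def ones_vec_carrier)
  have "(krylov_mat n A * shift_mat n f) $$ (i, j) = (\<Sum>k<n. g k * shift_mat n f $$ (k, j))"
    using ij by (simp add: times_mat_def krylov_mat_def shift_mat_def scalar_prod_def g_def e_def lessThan_atLeast0)
  also have "\<dots> = (if j < degree f then g j else ((A ^\<^sub>m m * poly_of_mat f A) *\<^sub>v e) $ i)"
  proof (cases "j < degree f")
    case True
    then have "(\<Sum>k<n. g k * shift_mat n f $$ (k, j)) = (\<Sum>k<n. if k = j then g j else 0)"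
      using ij by (intro sum.cong) (auto simp: shift_mat_def)
    with True ij show ?thesis
      by simp
  next
    case False
    have pA: "poly_of_mat f A \<in> carrier_mat n n"
      using A by (simp add: poly_of_mat_def)
    note Am = pow_carrier_mat[OF A, of m]
    have "((A ^\<^sub>m m * poly_of_mat f A) *\<^sub>v e) $ i = (A ^\<^sub>m m *\<^sub>v (poly_of_mat f A *\<^sub>v e)) $ i"
      by (simp only: assoc_mult_mat_vec[OF Am pA e])
    also have "\<dots> = (\<Sum>l<n. (A ^\<^sub>m m) $$ (i, l) * (poly_of_mat f A *\<^sub>v e) $ l)"
      by (rule mult_mat_vec_nth_sum[OF Am mult_mat_vec_carrier[OF pA e] ij(1)])
    also have "\<dots> = (\<Sum>l<n. \<Sum>k\<le>degree f. (A ^\<^sub>m m) $$ (i, l) * (poly.coeff f k * (A ^\<^sub>m k *\<^sub>v e) $ l))"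
      by (intro sum.cong) (auto simp: poly_of_mat_mult_vec[OF A e] sum_distrib_left)
    also have "\<dots> = (\<Sum>k\<le>degree f. \<Sum>l<n. poly.coeff f k * ((A ^\<^sub>m m) $$ (i, l) * (A ^\<^sub>m k *\<^sub>v e) $ l))"
      by (subst sum.swap) (simp add: algebra_simps)
    also have "\<dots> = (\<Sum>k\<le>degree f. poly.coeff f k * (A ^\<^sub>m m *\<^sub>v (A ^\<^sub>m k *\<^sub>v e)) $ i)"
      by (intro sum.cong refl, subst mult_mat_vec_nth_sum[OF Am mult_mat_vec_carrier[OF pow_carrier_mat[OF A] e] ij(1)])
        (simp add: sum_distrib_left)
    also have "\<dots> = (\<Sum>k\<le>degree f. poly.coeff f k * g (m + k))"
      by (simp only: pow_mat_add_mult_vec[OF A e] g_def)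
    \<comment> \<open>Since \<open>m + degree f = j < n\<close>, the shifted copy of
      \<open>f\<close> fits into the \<open>n\<close> available coefficients.\<close>
    also have "\<dots> = (\<Sum>k\<in>{m..m + degree f}. g k * poly.coeff f (k - m))"
      by (rule sum.reindex_bij_witness[of _ "\<lambda>k. k - m" "\<lambda>k. m + k"]) (auto simp: mult.commute)
    also have "\<dots> = (\<Sum>k<n. g k * shift_mat n f $$ (k, j))"
      using False ij
      by (intro sum.mono_neutral_cong_left) (auto simp: shift_mat_def m_def coeff_eq_0)
    finally show ?thesis
      using False by simp
  qed
  finally show ?thesis
    by (simp add: g_def m_def e_def)
qed

lemma mult_diag_mat_right:
  fixes X :: "'a :: comm_ring_1 mat"
  assumes "X \<in> carrier_mat n n"
  shows "X * mat n n (\<lambda>(i, j). if i = j then c j else 0) = mat n n (\<lambda>(i, j). X $$ (i, j) * c j)"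
proof (intro eq_matI)
  fix i j assume "i < dim_row (mat n n (\<lambda>(i, j). X $$ (i, j) * c j))"
    "j < dim_col (mat n n (\<lambda>(i, j). X $$ (i, j) * c j))"
  then have ij: "i < n" "j < n" by auto
  have "(X * mat n n (\<lambda>(i, j). if i = j then c j else 0)) $$ (i, j)
      = (\<Sum>k = 0..<n. X $$ (i, k) * (if k = j then c j else 0))"
    using ij assms by (simp add: scalar_prod_def)
  also have "\<dots> = (\<Sum>k = 0..<n. if k = j then X $$ (i, j) * c j else 0)"
    by (intro sum.cong) auto
  finally show "(X * mat n n (\<lambda>(i, j). if i = j then c j else 0)) $$ (i, j)
      = mat n n (\<lambda>(i, j). X $$ (i, j) * c j) $$ (i, j)"
    using ij by simp
qed (use assms in auto)

text \<open>The division by \<open>p\<close> is exact only if \<open>p\<close> divides \<open>f(A) e\<close>.\<close>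

definition reduced_krylov_mat :: "nat \<Rightarrow> int \<Rightarrow> int poly \<Rightarrow> int mat \<Rightarrow> int mat" where
  "reduced_krylov_mat n p f A = mat n n (\<lambda>(i, j).
     (krylov_mat n A * shift_mat n f) $$ (i, j) div (if j < degree f then 1 else p))"

lemma reduced_krylov_mat_carrier: "reduced_krylov_mat n p f A \<in> carrier_mat n n"
  by (simp add: reduced_krylov_mat_def)

lemma dvd_krylov_mat_mult_shift_mat:
  fixes A :: "int mat"
  assumes A: "A \<in> carrier_mat n n" and ij: "i < n" "j < n"
    and dvd: "\<And>i. i < n \<Longrightarrow> p dvd (poly_of_mat f A *\<^sub>v ones_vec n) $ i"
  shows "(if j < degree f then 1 else p) dvd (krylov_mat n A * shift_mat n f) $$ (i, j)"
proof (cases "j < degree f")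
  case False
  have pA: "poly_of_mat f A \<in> carrier_mat n n"
    using A by (simp add: poly_of_mat_def)
  note Am = pow_carrier_mat[OF A, of "j - degree f"]
  have "p dvd (A ^\<^sub>m (j - degree f) *\<^sub>v (poly_of_mat f A *\<^sub>v ones_vec n)) $ i"
    unfolding mult_mat_vec_nth_sum[OF Am mult_mat_vec_carrier[OF pA ones_vec_carrier] ij(1)]
    using dvd by (intro dvd_sum dvd_mult) simp
  with False show ?thesis
    by (simp only: krylov_mat_mult_shift_mat[OF A ij] assoc_mult_mat_vec[OF Am pA ones_vec_carrier]) simp
qed simp

text \<open>Writing the exact division as a product with a diagonal matrix lets determinants and
  intertwining relations pass from the Krylov matrix to the reduced one.\<close>

lemma reduced_krylov_mat_mult_diag:
  fixes A :: "int mat"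
  assumes A: "A \<in> carrier_mat n n"
    and dvd: "\<And>i. i < n \<Longrightarrow> p dvd (poly_of_mat f A *\<^sub>v ones_vec n) $ i"
  shows "reduced_krylov_mat n p f A * mat n n (\<lambda>(i, j). if i = j then if j < degree f then 1 else p else 0)
    = krylov_mat n A * shift_mat n f"
  unfolding mult_diag_mat_right[OF reduced_krylov_mat_carrier]
  using dvd_krylov_mat_mult_shift_mat[OF A _ _ dvd] krylov_mat_carrier[of n A] shift_mat_carrier[of n f]
  by (intro eq_matI) (auto simp: reduced_krylov_mat_def simp del: index_mult_mat(1))

section \<open>Transport along an intertwining matrix\<close>

lemma pow_mat_intertwine:
  fixes A :: "'a :: comm_ring_1 mat"
  assumes P: "P \<in> carrier_mat n n" and A: "A \<in> carrier_mat n n" and B: "B \<in> carrier_mat n n"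
    and eq: "P * A = B * P"
  shows "P * A ^\<^sub>m k = B ^\<^sub>m k * P"
proof (induction k)
  case 0
  then show ?case using P A B by simp
next
  case (Suc k)
  have "P * A ^\<^sub>m Suc k = (P * A ^\<^sub>m k) * A"
    using P A by (simp add: assoc_mult_mat[of _ n n _ n _ n])
  also have "\<dots> = B ^\<^sub>m k * (P * A)"
    using P A B by (simp add: Suc assoc_mult_mat[of _ n n _ n _ n])
  also have "\<dots> = B ^\<^sub>m Suc k * P"
    using P B by (simp add: eq assoc_mult_mat[of _ n n _ n _ n])
  finally show ?case .
qed

lemma krylov_mat_intertwine:
  fixes A :: "'a :: comm_ring_1 mat"
  assumes P: "P \<in> carrier_mat n n" and A: "A \<in> carrier_mat n n" and B: "B \<in> carrier_mat n n"
    and eq: "P * A = B * P" and Pe: "P *\<^sub>v ones_vec n = ones_vec n"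
  shows "P * krylov_mat n A = krylov_mat n B"
proof (intro eq_matI)
  fix i k assume "i < dim_row (krylov_mat n B)" "k < dim_col (krylov_mat n B)"
  then have ik: "i < n" "k < n" by (auto simp: krylov_mat_def)
  note Ak = pow_carrier_mat[OF A, of k]
  have "col (krylov_mat n A) k = A ^\<^sub>m k *\<^sub>v ones_vec n"
    using ik carrier_vecD[OF mult_mat_vec_carrier[OF Ak ones_vec_carrier]]
    by (intro eq_vecI) (simp_all add: krylov_mat_def)
  then have "(P * krylov_mat n A) $$ (i, k) = (P *\<^sub>v (A ^\<^sub>m k *\<^sub>v ones_vec n)) $ i"
    using ik P krylov_mat_carrier[of n A] by simp
  also have "P *\<^sub>v (A ^\<^sub>m k *\<^sub>v ones_vec n) = (P * A ^\<^sub>m k) *\<^sub>v ones_vec n"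
    by (rule assoc_mult_mat_vec[OF P Ak ones_vec_carrier, symmetric])
  also have "\<dots> = B ^\<^sub>m k *\<^sub>v (P *\<^sub>v ones_vec n)"
    unfolding pow_mat_intertwine[OF P A B eq]
    by (rule assoc_mult_mat_vec[OF pow_carrier_mat[OF B] P ones_vec_carrier])
  finally show "(P * krylov_mat n A) $$ (i, k) = krylov_mat n B $$ (i, k)"
    using ik by (simp add: Pe krylov_mat_def)
qed (use P in \<open>auto simp: krylov_mat_def\<close>)

lemma map_krylov_mat:
  fixes A :: "int mat"
  assumes A: "A \<in> carrier_mat n n"
  shows "map_mat of_int (krylov_mat n A) = krylov_mat n (map_mat of_int A :: 'a :: comm_ring_1 mat)"
proof (intro eq_matI)
  fix i k assume "i < dim_row (krylov_mat n (map_mat of_int A) :: 'a mat)"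
    "k < dim_col (krylov_mat n (map_mat of_int A) :: 'a mat)"
  then have ik: "i < n" "k < n" by (auto simp: krylov_mat_def)
  note Ak = pow_carrier_mat[OF A, of k]
  have "map_vec of_int (A ^\<^sub>m k *\<^sub>v ones_vec n)
      = map_mat of_int A ^\<^sub>m k *\<^sub>v (map_vec of_int (ones_vec n) :: 'a vec)"
    unfolding of_int_hom.mult_mat_vec_hom[OF Ak ones_vec_carrier] of_int_hom.mat_hom_pow[OF A] ..
  also have "map_vec of_int (ones_vec n) = (ones_vec n :: 'a vec)"
    by (auto simp: ones_vec_def)
  finally have "map_vec of_int (A ^\<^sub>m k *\<^sub>v ones_vec n) $ i
      = (map_mat of_int A ^\<^sub>m k *\<^sub>v (ones_vec n :: 'a vec)) $ i"
    by simp
  then show "map_mat of_int (krylov_mat n A) $$ (i, k) = krylov_mat n (map_mat of_int A :: 'a mat) $$ (i, k)"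
    using ik carrier_vecD[OF mult_mat_vec_carrier[OF Ak ones_vec_carrier]]
    by (simp add: krylov_mat_def)
qed (auto simp: krylov_mat_def)

text \<open>\<open>P\<close> acts from the left, while \<open>shift_mat\<close> and the diagonal
  matrix act from the right and depend only on \<open>f\<close> and \<open>p\<close>. The relation
  for Krylov matrices therefore carries over, and the nonzero diagonal is cancelled column by column
  over the rationals.\<close>

lemma reduced_krylov_mat_intertwine:
  fixes A B :: "int mat" and P :: "rat mat"
  assumes P: "P \<in> carrier_mat n n" and A: "A \<in> carrier_mat n n" and B: "B \<in> carrier_mat n n"
    and eq: "P * map_mat of_int A = map_mat of_int B * P" and Pe: "P *\<^sub>v ones_vec n = ones_vec n"
    and p: "p \<noteq> 0"
    and dvd: "\<And>i. i < n \<Longrightarrow> p dvd (poly_of_mat f A *\<^sub>v ones_vec n) $ i"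
      "\<And>i. i < n \<Longrightarrow> p dvd (poly_of_mat f B *\<^sub>v ones_vec n) $ i"
  shows "P * map_mat of_int (reduced_krylov_mat n p f A) = map_mat of_int (reduced_krylov_mat n p f B)"
proof -
  define c where "c j = (if j < degree f then 1 else p)" for j
  let ?C = "mat n n (\<lambda>(i, j). if i = j then c j else 0)"
  let ?h = "map_mat rat_of_int"
  let ?K = "reduced_krylov_mat n p f"
  have C: "?C \<in> carrier_mat n n" by simp
  have hC: "?h ?C = mat n n (\<lambda>(i, j). if i = j then rat_of_int (c j) else 0)"
    by (intro eq_matI) auto
  note K = reduced_krylov_mat_carrier[of n p f]
  note carr = krylov_mat_carrier[of n] shift_mat_carrier[of n f]
  note diag = reduced_krylov_mat_mult_diag[of _ n p f, folded c_def]
  have "(P * ?h (?K A)) * ?h ?C = P * ?h (?K A * ?C)"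
    using P K C by (simp add: of_int_hom.mat_hom_mult[OF K C] assoc_mult_mat[of _ n n _ n _ n])
  also have "?K A * ?C = krylov_mat n A * shift_mat n f"
    by (rule diag[OF A dvd(1)])
  also have "P * ?h \<dots> = (P * ?h (krylov_mat n A)) * ?h (shift_mat n f)"
    using P by (simp add: of_int_hom.mat_hom_mult[OF carr] krylov_mat_carrier shift_mat_carrier
        assoc_mult_mat[of _ n n _ n _ n])
  also have "P * ?h (krylov_mat n A) = ?h (krylov_mat n B)"
    unfolding map_krylov_mat[OF A] map_krylov_mat[OF B]
    using A B by (intro krylov_mat_intertwine[OF P _ _ eq Pe]) auto
  also have "\<dots> * ?h (shift_mat n f) = ?h (krylov_mat n B * shift_mat n f)"
    by (simp add: of_int_hom.mat_hom_mult[OF carr])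
  also have "krylov_mat n B * shift_mat n f = ?K B * ?C"
    by (rule diag[OF B dvd(2), symmetric])
  also have "?h \<dots> = ?h (?K B) * ?h ?C"
    by (rule of_int_hom.mat_hom_mult[OF K C])
  finally have main: "(P * ?h (?K A)) * ?h ?C = ?h (?K B) * ?h ?C" .
  have PK: "P * ?h (?K A) \<in> carrier_mat n n" and hK: "?h (?K B) \<in> carrier_mat n n"
    using P K by auto
  have c0: "c j \<noteq> 0" for j
    using p by (simp add: c_def)
  show ?thesis
  proof (intro eq_matI)
    fix i j assume "i < dim_row (?h (?K B))" "j < dim_col (?h (?K B))"
    then have ij: "i < n" "j < n" using hK by auto
    have "(P * ?h (?K A)) $$ (i, j) * rat_of_int (c j) = ?h (?K B) $$ (i, j) * rat_of_int (c j)"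
      using arg_cong[OF main[unfolded hC mult_diag_mat_right[OF PK] mult_diag_mat_right[OF hK]],
        of "\<lambda>X. X $$ (i, j)"] ij by simp
    then show "(P * ?h (?K A)) $$ (i, j) = ?h (?K B) $$ (i, j)"
      using c0[of j] by simp
  qed (use PK hK in auto)
qed

section \<open>Reduction modulo \<open>p\<close> and integrality of the reduced walk matrix\<close>

lemma of_int_mod_ring_eq_0_iff:
  "of_int k = (0 :: 'p :: prime_card mod_ring) \<longleftrightarrow> int CARD('p) dvd k"
  unfolding of_int_of_int_mod_ring by (transfer, auto simp: dvd_eq_mod_eq_0)

text \<open>\<open>annihilates_ones_vec\<close> over the field with \<open>p\<close> elements, read
  back over the integers. It is stated for any symmetric integer matrix because it is applied to
  both \<open>A\<close> and \<open>Q^T A Q\<close>.\<close>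

lemma CARD_dvd_annihilated_ones_vec:
  fixes A :: "int mat" and f :: "int poly"
  assumes A: "A \<in> carrier_mat n n" and sym: "transpose_mat A = A"
    and f: "of_int_poly f = (of_int_poly (char_poly A) :: 'p :: prime_card mod_ring poly) div
      poly_sqrt (gcd (of_int_poly (char_poly A)) (of_int_poly (char_poly (A + ones_mat n))))"
    and i: "i < n"
  shows "int CARD('p) dvd (poly_of_mat f A *\<^sub>v ones_vec n) $ i"
proof -
  let ?h = "of_int :: int \<Rightarrow> 'p mod_ring"
  let ?A = "map_mat ?h A"
  have hA: "?A \<in> carrier_mat n n"
    using A by simp
  have "map_mat ?h (A + ones_mat n) = ?A + ones_mat n"
    using A by (intro eq_matI) (auto simp: ones_mat_def)
  then have \<chi>: "char_poly ?A = of_int_poly (char_poly A)"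
    "char_poly (?A + ones_mat n) = of_int_poly (char_poly (A + ones_mat n))"
    using of_int_hom.char_poly_hom[OF A] of_int_hom.char_poly_hom[OF add_carrier_mat[OF ones_mat_carrier, of A]]
    by metis+
  have "transpose_mat ?A = ?A"
    by (metis map_mat_transpose sym)
  from annihilates_ones_vec[OF hA this]
  have "poly_of_mat (of_int_poly f) ?A *\<^sub>v ones_vec n = 0\<^sub>v n"
    by (simp only: \<chi> f)
  then have "0 = (\<Sum>k\<le>degree (map_poly ?h f). poly.coeff (map_poly ?h f) k * (?A ^\<^sub>m k *\<^sub>v ones_vec n) $ i)"
    using poly_of_mat_mult_vec[OF hA ones_vec_carrier i, of "of_int_poly f"] i by simp
  also have "\<dots> = (\<Sum>k\<le>degree f. poly.coeff (map_poly ?h f) k * (?A ^\<^sub>m k *\<^sub>v ones_vec n) $ i)"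
    by (rule coeff_sum_degree_le) (rule degree_map_poly_le)
  also have "\<dots> = (\<Sum>k\<le>degree f. ?h (poly.coeff f k * (A ^\<^sub>m k *\<^sub>v ones_vec n) $ i))"
  proof (intro sum.cong refl)
    fix k
    note Ak = pow_carrier_mat[OF A, of k]
    have "?A ^\<^sub>m k *\<^sub>v map_vec ?h (ones_vec n) = map_vec ?h (A ^\<^sub>m k *\<^sub>v ones_vec n)"
      unfolding of_int_hom.mult_mat_vec_hom[OF Ak ones_vec_carrier] of_int_hom.mat_hom_pow[OF A] ..
    moreover have "map_vec ?h (ones_vec n) = ones_vec n"
      by (auto simp: ones_vec_def)
    ultimately show "poly.coeff (map_poly ?h f) k * (?A ^\<^sub>m k *\<^sub>v ones_vec n) $ i
        = ?h (poly.coeff f k * (A ^\<^sub>m k *\<^sub>v ones_vec n) $ i)"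
      using i carrier_vecD[OF mult_mat_vec_carrier[OF Ak ones_vec_carrier]] by simp
  qed
  also have "\<dots> = ?h ((poly_of_mat f A *\<^sub>v ones_vec n) $ i)"
    by (simp add: poly_of_mat_mult_vec[OF A ones_vec_carrier i])
  finally show ?thesis
    by (simp add: of_int_mod_ring_eq_0_iff[symmetric])
qed

lemma adj_mat_carrier: "adj_mat n E \<in> carrier_mat n n"
  by (simp add: adj_mat_def)

lemma transpose_adj_mat: "transpose_mat (adj_mat n E) = adj_mat n E"
  by (intro eq_matI) (auto simp: adj_mat_def insert_commute)

lemma of_int_f_poly:
  "of_int_poly (f_poly TYPE('p :: prime_card) n E)
    = (of_int_poly (char_poly (adj_mat n E)) div poly_sqrt (Phi n E) :: 'p mod_ring poly)"
  by (intro poly_eqI) (simp add: f_poly_def coeff_map_poly of_int_of_int_mod_ring)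

text \<open>The square root divides \<open>Phi\<close> and hence the characteristic polynomial, and
  lifting to representatives keeps the degree. The bound makes the two column lists of the reduced
  walk matrix have total length \<open>n\<close>.\<close>

lemma f_poly_neq_0_degree_le:
  fixes n E
  defines "f \<equiv> f_poly TYPE('p :: prime_card) n E"
  shows "f \<noteq> 0" "degree f \<le> n"
proof -
  let ?\<chi> = "of_int_poly (char_poly (adj_mat n E)) :: 'p mod_ring poly"
  let ?s = "poly_sqrt (Phi n E) :: 'p mod_ring poly"
  have \<chi>: "?\<chi> = char_poly (map_mat of_int (adj_mat n E))"
    by (rule of_int_hom.char_poly_hom[OF adj_mat_carrier, symmetric])
  have hA: "map_mat of_int (adj_mat n E) \<in> carrier_mat n n"
    using adj_mat_carrier by simp
  have \<chi>0: "?\<chi> \<noteq> 0" and deg: "degree ?\<chi> = n"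
    unfolding \<chi> using char_poly_neq_0[OF hA] degree_monic_char_poly[OF hA] by auto
  have "Phi n E dvd ?\<chi>"
    by (simp add: Phi_def)
  then have "?s dvd ?\<chi>"
    using \<chi>0 by (metis dvd_0_left_iff dvd_trans poly_sqrt_dvd_self)
  then have eq: "?\<chi> = ?s * (?\<chi> div ?s)"
    by simp
  with \<chi>0 have "?s \<noteq> 0" "?\<chi> div ?s \<noteq> 0"
    by (metis mult_zero_left, metis mult_zero_right)
  with eq deg have le: "degree (?\<chi> div ?s) \<le> n"
    by (metis degree_mult_eq le_add2)
  have "degree f = degree (?\<chi> div ?s)"
    unfolding f_def f_poly_def by (rule to_int_mod_ring_hom.degree_map_poly_hom)
  with le show "degree f \<le> n"
    by simp
  show "f \<noteq> 0"
    using of_int_f_poly[where 'p = 'p, of n E] \<open>?\<chi> div ?s \<noteq> 0\<close> by (auto simp: f_def)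
qed

lemma walk_mat_eq_krylov_mat: "walk_mat n E = krylov_mat n (adj_mat n E)"
  by (intro eq_matI) (auto simp: walk_mat_def krylov_mat_def mat_of_cols_def)

text \<open>Divisibility makes the integer division agree with the rational one; the embedding of
  integer matrices is injective, so the definite description has this value.\<close>

lemma reduced_walk_mat_eq:
  fixes n E
  defines "f \<equiv> f_poly TYPE('p :: prime_card) n E"
  assumes dvd: "\<And>i. i < n \<Longrightarrow> int CARD('p) dvd (poly_of_mat f (adj_mat n E) *\<^sub>v ones_vec n) $ i"
  shows "reduced_walk_mat TYPE('p) n E = reduced_krylov_mat n (int CARD('p)) f (adj_mat n E)"
proof -
  let ?A = "adj_mat n E"
  let ?K = "reduced_krylov_mat n (int CARD('p)) f ?A"
  note deg = f_poly_neq_0_degree_le(2)[where 'p = 'p, of n E, folded f_def]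
  have K: "map_mat rat_of_int ?K = reduced_walk_mat_rat TYPE('p) n E"
  proof (intro eq_matI)
    fix i j assume "i < dim_row (reduced_walk_mat_rat TYPE('p) n E)"
      "j < dim_col (reduced_walk_mat_rat TYPE('p) n E)"
    with deg have ij: "i < n" "j < n"
      by (auto simp: reduced_walk_mat_rat_def Let_def f_def)
    have "rat_of_int (?K $$ (i, j)) = rat_of_int ((krylov_mat n ?A * shift_mat n f) $$ (i, j))
        / rat_of_int (if j < degree f then 1 else int CARD('p))"
      using ij dvd_krylov_mat_mult_shift_mat[OF adj_mat_carrier ij dvd]
      by (simp add: reduced_krylov_mat_def of_int_div del: index_mult_mat(1))
    also have "\<dots> = reduced_walk_mat_rat TYPE('p) n E $$ (i, j)"
      using ij deg
      by (auto simp: krylov_mat_mult_shift_mat[OF adj_mat_carrier ij] reduced_walk_mat_rat_def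
          Let_def f_def[symmetric] mat_of_cols_def nth_append
          carrier_matD(1)[OF adj_mat_carrier] simp del: index_mult_mat_vec)
    finally show "map_mat rat_of_int ?K $$ (i, j) = reduced_walk_mat_rat TYPE('p) n E $$ (i, j)"
      using ij reduced_krylov_mat_carrier[of n "int CARD('p)" f ?A] by simp
  qed (use deg in \<open>auto simp: reduced_walk_mat_rat_def Let_def f_def reduced_krylov_mat_def\<close>)
  show ?thesis
    unfolding reduced_walk_mat_def
  proof (rule the_equality)
    fix M assume "map_mat rat_of_int M = reduced_walk_mat_rat TYPE('p) n E"
    with K show "M = ?K"
      by (metis of_int_hom.mat_hom_inj)
  qed (rule K)
qed

text \<open>The similarity exists only over the rationals, but integer polynomials embed injectively
  there.\<close>

lemma char_poly_eq_if_rat_similar: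
  fixes A B :: "int mat" and P P' :: "rat mat"
  assumes A: "A \<in> carrier_mat n n" and B: "B \<in> carrier_mat n n"
    and P: "P \<in> carrier_mat n n" "P' \<in> carrier_mat n n" "P * P' = 1\<^sub>m n" "P' * P = 1\<^sub>m n"
    and eq: "map_mat of_int B = P * map_mat of_int A * P'"
  shows "char_poly B = char_poly A"
proof -
  have "similar_mat (map_mat rat_of_int B) (map_mat rat_of_int A)"
    using A B P eq by (intro similar_matI[of _ _ P P' n]) auto
  then have "char_poly (map_mat rat_of_int B) = char_poly (map_mat rat_of_int A)"
    by (rule char_poly_similar)
  then have "(of_int_poly (char_poly B) :: rat poly) = of_int_poly (char_poly A)"
    by (simp only: of_int_hom.char_poly_hom[OF A] of_int_hom.char_poly_hom[OF B])
  then show ?thesis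
    by simp
qed

section \<open>The level and its divisibility\<close>

lemma elements_mat_subset_iff:
  "elements_mat X \<subseteq> S \<longleftrightarrow> (\<forall>i<dim_row X. \<forall>j<dim_col X. X $$ (i, j) \<in> S)"
  by (auto simp: elements_mat_def UN_subset_iff image_subset_iff)

text \<open>Multipliers that make \<open>Q\<close> integral are closed under integer combinations,
  so the remainder of \<open>d\<close> modulo the level is one too; being smaller than the level, it
  must be 0.\<close>

lemma level_dvd:
  assumes d: "0 < d" and int: "elements_mat (of_nat d \<cdot>\<^sub>m Q) \<subseteq> \<int>"
  shows "level Q dvd d"
proof -
  define l where "l = level Q"
  let ?P = "\<lambda>k. 0 < k \<and> elements_mat (of_nat k \<cdot>\<^sub>m Q) \<subseteq> \<int>"
  have l: "?P l"
    unfolding l_def level_def by (rule LeastI[of ?P d]) (use d int in blast)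
  have "elements_mat (of_nat (d mod l) \<cdot>\<^sub>m Q) \<subseteq> \<int>"
    unfolding elements_mat_subset_iff
  proof (intro allI impI)
    fix i j assume "i < dim_row (of_nat (d mod l) \<cdot>\<^sub>m Q)" "j < dim_col (of_nat (d mod l) \<cdot>\<^sub>m Q)"
    then have ij: "i < dim_row Q" "j < dim_col Q" by auto
    have ints: "of_nat d * Q $$ (i, j) \<in> \<int>" "of_nat l * Q $$ (i, j) \<in> \<int>"
      using int l ij unfolding elements_mat_subset_iff by auto
    have "of_nat d * Q $$ (i, j) - of_nat (d div l) * (of_nat l * Q $$ (i, j)) \<in> \<int>"
      by (rule Ints_diff[OF ints(1) Ints_mult[OF Ints_of_nat ints(2)]])
    also have "of_nat d * Q $$ (i, j) - of_nat (d div l) * (of_nat l * Q $$ (i, j))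
        = (of_nat d - of_nat (d div l * l)) * Q $$ (i, j)"
      by (simp add: algebra_simps)
    also have "of_nat d - of_nat (d div l * l) = (of_nat (d mod l) :: rat)"
      by (simp only: minus_div_mult_eq_mod[symmetric] of_nat_diff[OF div_times_less_eq_dividend])
    finally show "(of_nat (d mod l) \<cdot>\<^sub>m Q) $$ (i, j) \<in> \<int>"
      using ij by simp
  qed
  moreover have "\<not> ?P (d mod l)"
    using l mod_less_divisor[of l d] not_less_Least[of _ ?P] unfolding l_def level_def by blast
  ultimately show ?thesis
    by (auto simp: l_def)
qed

text \<open>The whole level divides the invariant factor, not only its \<open>p\<close>-part.
  Positivity is recorded because the multiplicity bound needs a nonzero number.\<close>

lemma level_dvd_last_invariant_factor:
  fixes n :: nat and E :: "nat set set" and Q :: "rat mat"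
  assumes ctrl: "controllable n E" and Q: "Q \<in> QG n E" and n: "0 < n"
  shows "int (level Q) dvd last_invariant_factor (reduced_walk_mat TYPE('p :: prime_card) n E)"
    and "0 < last_invariant_factor (reduced_walk_mat TYPE('p) n E)"
proof -
  define A where "A = adj_mat n E"
  define f where "f = f_poly TYPE('p) n E"
  define p where "p = int CARD('p)"
  let ?h = "map_mat rat_of_int"
  let ?e = "ones_vec n"
  have A: "A \<in> carrier_mat n n" and symA: "transpose_mat A = A"
    by (auto simp: A_def adj_mat_carrier transpose_adj_mat)
  have hA: "?h A \<in> carrier_mat n n"
    using A by simp
  have p: "p \<noteq> 0"
    by (simp add: p_def)
  from Q have Qc: "Q \<in> carrier_mat n n" and QtQ: "transpose_mat Q * Q = 1\<^sub>m n"
    and Qe: "Q *\<^sub>v ?e = ?e" and zo: "zero_one_mat (transpose_mat Q * ?h A * Q)"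
    by (auto simp: QG_def regular_orthogonal_mat_def A_def)
  define P where "P = transpose_mat Q"
  have P: "P \<in> carrier_mat n n"
    using Qc by (simp add: P_def)
  have PQ: "P * Q = 1\<^sub>m n"
    using QtQ by (simp add: P_def)
  have QP: "Q * P = 1\<^sub>m n"
    using mat_mult_left_right_inverse[OF P Qc PQ] .
  have Pe: "P *\<^sub>v ?e = ?e"
    using assoc_mult_mat_vec[OF P Qc ones_vec_carrier] by (simp add: Qe PQ ones_vec_carrier)
  \<comment> \<open>All entries are 0 or 1, so \<open>floor\<close> merely changes the type to
    integers.\<close>
  define B where "B = map_mat floor (P * ?h A * Q)"
  have B: "B \<in> carrier_mat n n"
    using mult_carrier_mat[OF mult_carrier_mat[OF P hA] Qc] by (simp add: B_def)
  have hB: "?h B = P * ?h A * Q"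
  proof (intro eq_matI)
    fix i j assume "i < dim_row (P * ?h A * Q)" "j < dim_col (P * ?h A * Q)"
    moreover from this zo have "(P * ?h A * Q) $$ (i, j) \<in> {0, 1}"
      unfolding zero_one_mat_def elements_mat_subset_iff P_def by blast
    ultimately show "?h B $$ (i, j) = (P * ?h A * Q) $$ (i, j)"
      by (auto simp: B_def simp del: index_mult_mat(1))
  qed (auto simp: B_def)
  have "?h (transpose_mat B) = transpose_mat (P * ?h A * Q)"
    by (simp only: map_mat_transpose hB[symmetric])
  also have "\<dots> = P * ?h (transpose_mat A) * Q"
    using Qc hA P by (simp add: P_def transpose_mult[of _ n n _ n] map_mat_transpose assoc_mult_mat[of _ n n _ n _ n])
  also have "\<dots> = ?h B"
    by (simp only: symA hB)
  finally have symB: "transpose_mat B = B"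
    by (rule of_int_hom.mat_hom_inj)
  have eq: "P * ?h A = ?h B * P"
    using P Qc hA by (simp add: hB assoc_mult_mat[of _ n n _ n _ n] QP)
  note J = ones_mat_carrier[of n]
  \<comment> \<open>The column sums of \<open>Q\<close> are the entries of \<open>P\<close> applied
    to the all-ones vector. With \<open>PJ\<close> this makes \<open>B + J\<close> conjugate to
    \<open>A + J\<close>, so that \<open>A\<close> and \<open>B\<close> share both characteristic
    polynomials in \<open>Phi\<close>.\<close>
  have JQ: "ones_mat n * Q = ones_mat n"
  proof (intro eq_matI)
    fix i j assume "i < dim_row (ones_mat n :: rat mat)" "j < dim_col (ones_mat n :: rat mat)"
    then have ij: "i < n" "j < n" by (auto simp: ones_mat_def)
    have "(ones_mat n * Q) $$ (i, j) = (P *\<^sub>v ?e) $ j"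
      using ij Qc by (simp add: P_def ones_mat_def ones_vec_def scalar_prod_def)
    then show "(ones_mat n * Q) $$ (i, j) = ones_mat n $$ (i, j)"
      using ij unfolding Pe by (simp add: ones_mat_def ones_vec_def)
  qed (use Qc in \<open>auto simp: ones_mat_def\<close>)
  have "transpose_mat (ones_mat n) = (ones_mat n :: rat mat)"
    by (intro eq_matI) (auto simp: ones_mat_def)
  then have PJ: "P * ones_mat n = ones_mat n"
    using arg_cong[OF JQ, of transpose_mat] transpose_mult[OF J Qc] by (simp add: P_def)
  have "?h (B + ones_mat n) = ?h B + ones_mat n"
    using B by (intro eq_matI) (auto simp: ones_mat_def)
  also have "\<dots> = P * ?h A * Q + P * ones_mat n * Q"
    by (simp only: hB PJ JQ)
  also have "\<dots> = (P * ?h A + P * ones_mat n) * Q"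
    by (rule add_mult_distrib_mat[OF mult_carrier_mat[OF P hA] mult_carrier_mat[OF P J] Qc, symmetric])
  also have "\<dots> = P * (?h A + ones_mat n) * Q"
    by (simp only: mult_add_distrib_mat[OF P hA J])
  also have "?h A + ones_mat n = ?h (A + ones_mat n)"
    using A by (intro eq_matI) (auto simp: ones_mat_def)
  finally have hBJ: "?h (B + ones_mat n) = P * ?h (A + ones_mat n) * Q" .
  have "char_poly B = char_poly A"
    by (rule char_poly_eq_if_rat_similar[OF A B P Qc PQ QP hB])
  moreover have "char_poly (B + ones_mat n) = char_poly (A + ones_mat n)"
    by (rule char_poly_eq_if_rat_similar[OF add_carrier_mat[OF J] add_carrier_mat[OF J] P Qc PQ QP hBJ])
  \<comment> \<open>The polynomial \<open>f\<close> is built from \<open>A\<close>, but equality of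
    both characteristic polynomials makes it the right one for \<open>B\<close> too.\<close>
  ultimately have dvd: "p dvd (poly_of_mat f A *\<^sub>v ?e) $ i" "p dvd (poly_of_mat f B *\<^sub>v ?e) $ i"
    if "i < n" for i
    unfolding p_def
    using CARD_dvd_annihilated_ones_vec[OF A symA _ that, of f, where 'p = 'p]
      CARD_dvd_annihilated_ones_vec[OF B symB _ that, of f, where 'p = 'p]
      of_int_f_poly[where 'p = 'p, of n E]
    by (simp_all add: f_def[symmetric] A_def[symmetric] Phi_def)
  let ?K = "reduced_krylov_mat n p f"
  note K = reduced_krylov_mat_carrier[of n p f]
  have W: "reduced_walk_mat TYPE('p) n E = ?K A"
    using dvd(1) unfolding A_def f_def p_def by (rule reduced_walk_mat_eq)
  define C where "C = mat n n (\<lambda>(i, j). if i = j then if j < degree f then 1 else p else 0)"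
  have C: "C \<in> carrier_mat n n"
    by (simp add: C_def)
  have "?K A * C = krylov_mat n A * shift_mat n f"
    unfolding C_def by (rule reduced_krylov_mat_mult_diag[OF A dvd(1)])
  \<comment> \<open>Controllability says that the Krylov matrix is non-singular; with
    \<open>shift_mat\<close> non-singular as well, so is \<open>?K A\<close>.\<close>
  then have "det (?K A) * det C = det (krylov_mat n A) * det (shift_mat n f)"
    by (metis det_mult[OF K C] det_mult[OF krylov_mat_carrier shift_mat_carrier])
  moreover have "det (krylov_mat n A) \<noteq> 0"
    using ctrl by (simp add: controllable_def walk_mat_eq_krylov_mat A_def)
  ultimately have det0: "det (?K A) \<noteq> 0"
    using det_shift_mat_neq_0 f_poly_neq_0_degree_le(1)[where 'p = 'p, of n E] unfolding f_def by force
  define d where "d = last_invariant_factor (?K A)"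
  from last_invariant_factor[OF K det0 n] obtain X where d: "0 < d" and X: "X \<in> carrier_mat n n"
    and KX: "?K A * X = d \<cdot>\<^sub>m 1\<^sub>m n"
    by (auto simp: d_def)
  \<comment> \<open>The left side is integral by construction and will turn out to be
    \<open>d\<close> times the transpose of \<open>Q\<close>.\<close>
  have "?h (?K B * X) = P * ?h (?K A) * ?h X"
    using reduced_krylov_mat_intertwine[OF P A B eq Pe p dvd]
    by (simp add: of_int_hom.mat_hom_mult[OF K X])
  also have "\<dots> = P * ?h (d \<cdot>\<^sub>m 1\<^sub>m n)"
    using assoc_mult_mat[OF P map_carrier_mat[THEN iffD2, OF K] map_carrier_mat[THEN iffD2, OF X]]
    by (simp add: of_int_hom.mat_hom_mult[OF K X, symmetric] KX)
  also have "?h (d \<cdot>\<^sub>m 1\<^sub>m n) = of_int d \<cdot>\<^sub>m 1\<^sub>m n"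
    by (intro eq_matI) auto
  also have "P * (of_int d \<cdot>\<^sub>m 1\<^sub>m n) = of_int d \<cdot>\<^sub>m P"
    using P by (simp add: mult_smult_distrib[OF P one_carrier_mat])
  finally have KBX: "?h (?K B * X) = of_int d \<cdot>\<^sub>m P" .
  have "elements_mat (of_nat (nat d) \<cdot>\<^sub>m Q) \<subseteq> \<int>"
    unfolding elements_mat_subset_iff
  proof (intro allI impI)
    fix i j assume "i < dim_row (of_nat (nat d) \<cdot>\<^sub>m Q)" "j < dim_col (of_nat (nat d) \<cdot>\<^sub>m Q)"
    then have ij: "i < n" "j < n" using Qc by auto
    have "(of_nat (nat d) \<cdot>\<^sub>m Q) $$ (i, j) = (of_int d \<cdot>\<^sub>m P) $$ (j, i)"
      using ij Qc d by (simp add: P_def)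
    also have "\<dots> = of_int ((?K B * X) $$ (j, i))"
      unfolding KBX[symmetric] using ij K[of B] X by (intro index_map_mat) auto
    finally show "(of_nat (nat d) \<cdot>\<^sub>m Q) $$ (i, j) \<in> \<int>"
      by simp
  qed
  then have "level Q dvd nat d"
    using d by (intro level_dvd) auto
  then have "int (level Q) dvd int (nat d)"
    by (simp only: of_nat_dvd_iff)
  with d show "int (level Q) dvd last_invariant_factor (reduced_walk_mat TYPE('p) n E)"
    "0 < last_invariant_factor (reduced_walk_mat TYPE('p) n E)"
    unfolding W d_def[symmetric] by simp_all
qed

theorem theorem3p6:
  fixes n p :: nat and E :: "nat set set" and Q :: "rat mat"
  assumes "simple_graph n E"
    and "controllable n E"
    and "Q \<in> QG n E"
    and "prime p" and "int p dvd det (walk_mat n E)"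
    and "CARD('p :: prime_card) = p"
  shows "multiplicity p (level Q)
    \<le> multiplicity (int p) (last_invariant_factor (reduced_walk_mat TYPE('p) n E))"
proof -
  let ?d = "last_invariant_factor (reduced_walk_mat TYPE('p) n E)"
  \<comment> \<open>For \<open>n = 0\<close> the determinant is 1, which no prime divides.\<close>
  have "0 < n"
  proof (rule ccontr)
    assume "\<not> 0 < n"
    then have "det (walk_mat n E) = 1"
      by (simp add: walk_mat_eq_krylov_mat krylov_mat_def det_def)
    with assms(4,5) show False
      by (metis not_prime_unit of_nat_1 of_nat_dvd_iff)
  qed
  note level = level_dvd_last_invariant_factor[where 'p = 'p, OF assms(2,3) this]
  have "p ^ multiplicity p (level Q) dvd level Q"
    by (rule multiplicity_dvd)
  then have "int p ^ multiplicity p (level Q) dvd int (level Q)"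
    by (metis of_nat_dvd_iff of_nat_power)
  then have "int p ^ multiplicity p (level Q) dvd ?d"
    using level(1) by (rule dvd_trans)
  then show ?thesis
    using level(2) assms(4) by (intro multiplicity_geI) (auto simp: prime_nat_iff)
qed

end
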